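(* Let $n\ge2$. For each $\sigma>0$ there exists a constant $m(\sigma,n)>0$, depending only on $\sigma$ and $n$, such that for all $\alpha\ge0$ $$\lambda_\alpha\le 2(n+1)+m(\sigma,n)\,\alpha^{1+\sigma},$$ where $\lambda_\alpha=\sup_{f\in\mathcal F_\alpha}|\nabla J_f(0)|$.
   Context: $\mathbb P^n=\{z\in\mathbb C^n:|z_i|<1,\ i=1,\dots,n\}$; $|\cdot|$ is the Euclidean norm. For a locally biholomorphic $f=(f_1,\dots,f_n)$ with complex Jacobian determinant $J_f=\det Df$, the Schwarzian derivatives are $$S^k_{ij}f=\sum_{l=1}^n\frac{\partial^2 f_l}{\partial z_i\partial z_j}\frac{\partial z_k}{\partial f_l}-\frac1{n+1}\Big(\delta^k_i\frac{\partial}{\partial z_j}+\delta^k_j\frac{\partial}{\partial z_i}\Big)\log J_f,\qquad i,j,k=1,\dots,n,$$ where $\partial z_k/\partial f_l$ is the $(k,l)$ entry of $(Df)^{-1}$. The Schwarzian operator is $S_f(z)(\vec v)=(\vec v^{\,t}S^1_f(z)\vec v,\dots,\vec v^{\,t}S^n_f(z)\vec v)$, where $S^k_f=(S^k_{ij}f)_{i,j}$. The Bergman norm of $\vec v\in T_z\mathbb P^n$ is $\|\vec v\|=\big[2\sum_i|v_i|^2/(1-|z_i|^2)^2\big]^{1/2}$; $\|S_f(z)\|=\sup_{\|\vec v\|=1}\|S_f(z)(\vec v)\|$ and $\|S_f\|=\sup_{z\in\mathbb P^n}\|S_f(z)\|$. $\mathcal F_\alpha$ is the set of locally biholomorphic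 $f:\mathbb P^n\to\mathbb C^n$ with $f(0)=0$, $Df(0)=I$, $\|S_f\|\le\alpha$. *)

theory Defs
  imports "HOL-Complex_Analysis.Complex_Analysis"
begin

definition polydisc :: "(complex ^ 'n) set" where
  "polydisc = {z. \<forall>i. cmod (z $ i) < 1}"

text \<open>On an open set this is the usual notion of a holomorphic map: the real Frechet derivative
  exists at every point and is complex linear.\<close>

definition holomorphic_map_on :: "(complex ^ 'n \<Rightarrow> complex ^ 'm) \<Rightarrow> (complex ^ 'n) set \<Rightarrow> bool" where
  "holomorphic_map_on f S \<longleftrightarrow> (\<forall>z\<in>S. \<exists>A :: complex ^ 'n ^ 'm. (f has_derivative (\<lambda>v. A *v v)) (at z))"

definition locally_biholomorphic_on ::
  "(complex ^ 'n \<Rightarrow> complex ^ 'n) \<Rightarrow> (complex ^ 'n) set \<Rightarrow> bool" where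
  "locally_biholomorphic_on f S \<longleftrightarrow>
     (\<forall>z\<in>S. \<exists>U V g. z \<in> U \<and> U \<subseteq> S \<and> open U \<and> open V \<and> homeomorphism U V f g \<and>
        holomorphic_map_on f U \<and> holomorphic_map_on g V)"

definition partial :: "'n \<Rightarrow> (complex ^ 'n \<Rightarrow> complex) \<Rightarrow> complex ^ 'n \<Rightarrow> complex" where
  "partial i g z = deriv (\<lambda>t. g (z + axis i t)) 0"

definition jacobian_mat :: "(complex ^ 'n \<Rightarrow> complex ^ 'n) \<Rightarrow> complex ^ 'n \<Rightarrow> complex ^ 'n ^ 'n" where
  "jacobian_mat f z = (\<chi> l j. partial j (\<lambda>x. f x $ l) z)"

definition jacobian_det :: "(complex ^ 'n \<Rightarrow> complex ^ 'n) \<Rightarrow> complex ^ 'n \<Rightarrow> complex" where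
  "jacobian_det f z = det (jacobian_mat f z)"

definition gradient :: "(complex ^ 'n \<Rightarrow> complex) \<Rightarrow> complex ^ 'n \<Rightarrow> complex ^ 'n" where
  "gradient g z = (\<chi> i. partial i g z)"

text \<open>The derivative of any local branch of \<open>log g\<close> (see \<open>partial_log_branch\<close> below). The
  principal branch \<open>Ln\<close> would give a wrong value where \<open>g\<close> hits the branch cut.\<close>

definition partial_log :: "'n \<Rightarrow> (complex ^ 'n \<Rightarrow> complex) \<Rightarrow> complex ^ 'n \<Rightarrow> complex" where
  "partial_log i g z = partial i g z / g z"

lemma partial_log_branch:
  fixes g L :: "complex ^ 'n \<Rightarrow> complex"
  assumes branch: "eventually (\<lambda>x. exp (L x) = g x) (nhds z)"
    and L: "(\<lambda>t. L (z + axis i t)) field_differentiable (at 0)"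
  shows "partial i L z = partial_log i g z"
proof -
  have z0: "z + axis i 0 = z"
    by (simp add: vec_eq_iff axis_def)
  have "((\<lambda>t. axis i t :: complex ^ 'n) \<longlongrightarrow> axis i 0) (nhds 0)"
  proof (rule vec_tendstoI)
    fix j show "((\<lambda>t. axis i t $ j :: complex) \<longlongrightarrow> axis i 0 $ j) (nhds 0)"
      by (cases "j = i") (auto simp: axis_def filterlim_ident)
  qed
  then have "((\<lambda>t. z + axis i t) \<longlongrightarrow> z) (nhds 0)"
    using tendsto_add[OF tendsto_const[of z]] z0 by metis
  with branch have ev: "eventually (\<lambda>t. exp (L (z + axis i t)) = g (z + axis i t)) (nhds 0)"
    by (auto simp: filterlim_iff)
  have "((\<lambda>t. exp (L (z + axis i t))) has_field_derivative exp (L z) * partial i L z) (at 0)"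
    unfolding partial_def
    using DERIV_chain2[OF DERIV_exp, OF field_differentiable_derivI[OF L]] by (simp add: z0)
  then have "partial i (\<lambda>x. exp (L x)) z = exp (L z) * partial i L z"
    by (simp add: partial_def DERIV_imp_deriv)
  moreover have "partial i (\<lambda>x. exp (L x)) z = partial i g z"
    unfolding partial_def using ev by (intro deriv_cong_ev) auto
  moreover have "exp (L z) = g z"
    using branch by (rule eventually_nhds_x_imp_x)
  ultimately show ?thesis
    by (metis exp_not_eq_zero nonzero_mult_div_cancel_left partial_log_def)
qed

text \<open>\<open>schwarzian f k z $ i $ j\<close> is \<open>S\<^sup>k\<^sub>i\<^sub>j f (z)\<close>.\<close>

definition schwarzian ::
  "(complex ^ 'n \<Rightarrow> complex ^ 'n) \<Rightarrow> 'n \<Rightarrow> complex ^ 'n \<Rightarrow> complex ^ 'n ^ 'n" where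
  "schwarzian f k z = (\<chi> i j.
     (\<Sum>l\<in>UNIV. partial i (partial j (\<lambda>x. f x $ l)) z * matrix_inv (jacobian_mat f z) $ k $ l)
     - 1 / (of_nat CARD('n) + 1) *
       ((if k = i then 1 else 0) * partial_log j (jacobian_det f) z
        + (if k = j then 1 else 0) * partial_log i (jacobian_det f) z))"

text \<open>The bilinear form is complex bilinear: there is no conjugation in \<open>v\<^sup>t S v\<close>.\<close>

definition schwarzian_op ::
  "(complex ^ 'n \<Rightarrow> complex ^ 'n) \<Rightarrow> complex ^ 'n \<Rightarrow> complex ^ 'n \<Rightarrow> complex ^ 'n" where
  "schwarzian_op f z v = (\<chi> k. \<Sum>i\<in>UNIV. \<Sum>j\<in>UNIV. v $ i * schwarzian f k z $ i $ j * v $ j)"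

definition bergman_norm :: "complex ^ 'n \<Rightarrow> complex ^ 'n \<Rightarrow> real" where
  "bergman_norm z v = sqrt (2 * (\<Sum>i\<in>UNIV. (cmod (v $ i))\<^sup>2 / (1 - (cmod (z $ i))\<^sup>2)\<^sup>2))"

text \<open>Suprema are taken in the extended reals, so that an unbounded supremum is \<open>\<infinity>\<close>.\<close>

definition schwarzian_norm_at :: "(complex ^ 'n \<Rightarrow> complex ^ 'n) \<Rightarrow> complex ^ 'n \<Rightarrow> ereal" where
  "schwarzian_norm_at f z =
     (SUP v\<in>{v. bergman_norm z v = 1}. ereal (bergman_norm z (schwarzian_op f z v)))"

definition schwarzian_norm :: "(complex ^ 'n \<Rightarrow> complex ^ 'n) \<Rightarrow> ereal" where
  "schwarzian_norm f = (SUP z\<in>polydisc. schwarzian_norm_at f z)"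

definition schwarzian_family :: "real \<Rightarrow> (complex ^ 'n \<Rightarrow> complex ^ 'n) set" where
  "schwarzian_family \<alpha> = {f. locally_biholomorphic_on f polydisc \<and> f 0 = 0 \<and>
     jacobian_mat f 0 = mat 1 \<and> schwarzian_norm f \<le> ereal \<alpha>}"

definition family_order :: "'n::finite itself \<Rightarrow> real \<Rightarrow> ereal" where
  "family_order _ \<alpha> = (SUP f\<in>(schwarzian_family \<alpha> :: (complex ^ 'n \<Rightarrow> complex ^ 'n) set).
     ereal (norm (gradient (jacobian_det f) 0)))"

end

theory Submission imports Defs begin

unbundle no Formal_Power_Series.fps_syntax

text \<open>Put \<open>n = CARD('n)\<close> and \<open>u = J\<^sub>f\<close> to the power \<open>-1/(n+1)\<close>. The coefficients \<open>\<Gamma>\<close> in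
  \<open>\<partial>\<^sub>i \<partial>\<^sub>j f\<^sub>l = \<Sum>\<^sub>k \<Gamma>\<^sup>k\<^sub>i\<^sub>j \<partial>\<^sub>k f\<^sub>l\<close> form a flat connection, and for \<open>n \<ge> 2\<close> the contraction of the
  flatness equation turns into a linear system
  \<open>\<partial>\<^sub>i \<partial>\<^sub>j u = \<Sum>\<^sub>k S\<^sup>k\<^sub>i\<^sub>j \<partial>\<^sub>k u + R\<^sub>i\<^sub>j u\<close>, where \<open>R\<close> is polynomial in \<open>S\<close> and its first
  derivatives. On compact parts of the polydisc \<open>S = O(\<alpha>)\<close>, hence \<open>R = O(\<alpha> + \<alpha>\<^sup>2)\<close> by Cauchy's
  estimate. On the disc \<open>z = t \<zeta>\<close> with \<open>\<zeta>\<close> proportional to the conjugate of \<open>\<nabla>u(0)\<close>, \<open>u\<close> is therefore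
  close to \<open>1 + A t\<close>, \<open>A = |\<nabla>u(0)|\<close>, for \<open>|t| \<le> \<rho>\<close> with \<open>\<rho> = min (3/4) (c/\<alpha>)\<close>. Since \<open>u\<close> has no zeros,
  \<open>A \<le> 3/(2\<rho>)\<close>. This is \<open>2\<close> for small \<open>\<alpha>\<close> and linear in \<open>\<alpha>\<close> otherwise, and
  \<open>|\<nabla>J\<^sub>f(0)| = (n + 1) A\<close>.\<close>

section \<open>Holomorphic functions of several variables\<close>

text \<open>Fixing the coefficients as \<open>partial j g z\<close> makes the total derivative and
  the one-variable derivatives behind \<open>partial\<close> interchangeable;
  \<open>mholomorphic_onI\<close> accepts any complex linear derivative.\<close>

definition mholomorphic_on :: "(complex ^ 'n \<Rightarrow> complex) \<Rightarrow> (complex ^ 'n) set \<Rightarrow> bool"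
    (infixl "mholomorphic'_on" 50) where
  "g mholomorphic_on S \<longleftrightarrow>
     (\<forall>z\<in>S. (g has_derivative (\<lambda>v. \<Sum>j\<in>UNIV. partial j g z * v $ j)) (at z))"

lemma smult_axis: "t *s axis i (1::complex) = axis i t"
  by (simp add: vec_eq_iff axis_def)

lemma partial_eq_deriv_line: "partial i g z = deriv (\<lambda>t. g (z + t *s axis i 1)) 0"
  by (simp add: partial_def smult_axis)

lemma has_derivative_line:
  "((\<lambda>t. z + t *s v) has_derivative (\<lambda>h. h *s v)) (at t)" for z v :: "complex ^ 'n"
proof -
  have "linear (\<lambda>h. h *s v)"
    by (rule linearI) (simp_all add: vec_eq_iff algebra_simps)
  then have "((\<lambda>h. h *s v) has_derivative (\<lambda>h. h *s v)) (at t)"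
    by (simp add: linear_conv_bounded_linear bounded_linear_imp_has_derivative)
  then show ?thesis
    by (auto intro!: derivative_eq_intros)
qed

lemma continuous_on_line [continuous_intros]:
  "continuous_on S f \<Longrightarrow> continuous_on S (\<lambda>x. f x *s v)" for v :: "complex ^ 'n"
  unfolding vector_scalar_mult_def by (intro continuous_intros)

lemma DERIV_line:
  fixes g :: "complex ^ 'n \<Rightarrow> complex"
  assumes "(g has_derivative (\<lambda>v. \<Sum>j\<in>UNIV. c j * v $ j)) (at (z + t *s v))"
  shows "((\<lambda>t. g (z + t *s v)) has_field_derivative (\<Sum>j\<in>UNIV. c j * v $ j)) (at t)"
  unfolding has_field_derivative_def
  by (rule has_derivative_eq_rhs[OF has_derivative_compose[OF has_derivative_line assms]])
     (simp add: fun_eq_iff sum_distrib_right sum_distrib_left algebra_simps)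

text \<open>Restriction to a coordinate line leaves a one-variable derivative, whose uniqueness
  forces the coefficient. This turns each \<open>has_derivative\<close> rule into a rule for
  \<open>partial\<close>.\<close>

lemma partial_eqI:
  fixes g :: "complex ^ 'n \<Rightarrow> complex"
  assumes "(g has_derivative (\<lambda>v. \<Sum>j\<in>UNIV. c j * v $ j)) (at z)"
  shows "partial i g z = c i"
proof -
  have "((\<lambda>t. g (z + t *s axis i 1)) has_field_derivative (\<Sum>j\<in>UNIV. c j * axis i 1 $ j)) (at 0)"
    by (rule DERIV_line) (use assms in simp)
  moreover have "(\<Sum>j\<in>UNIV. c j * axis i 1 $ j) = c i"
    by (simp add: axis_def if_distrib cong: if_cong)
  ultimately show ?thesis
    by (simp add: partial_eq_deriv_line DERIV_imp_deriv)
qed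

lemma mholomorphic_onI:
  assumes "\<And>z. z \<in> S \<Longrightarrow> (g has_derivative (\<lambda>v. \<Sum>j\<in>UNIV. c z j * v $ j)) (at z)"
  shows "g mholomorphic_on S"
  unfolding mholomorphic_on_def
proof
  fix z assume "z \<in> S"
  show "(g has_derivative (\<lambda>v. \<Sum>j\<in>UNIV. partial j g z * v $ j)) (at z)"
    unfolding partial_eqI[OF assms[OF \<open>z \<in> S\<close>]] by (rule assms[OF \<open>z \<in> S\<close>])
qed

lemma mholomorphic_onD:
  "g mholomorphic_on S \<Longrightarrow> z \<in> S \<Longrightarrow>
     (g has_derivative (\<lambda>v. \<Sum>j\<in>UNIV. partial j g z * v $ j)) (at z)"
  by (simp add: mholomorphic_on_def)

lemma mholomorphic_on_imp_continuous_on: "g mholomorphic_on S \<Longrightarrow> continuous_on S g"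
  by (meson continuous_at_imp_continuous_on has_derivative_continuous mholomorphic_onD)

lemma mholomorphic_DERIV_line:
  assumes "g mholomorphic_on S" "z + t *s v \<in> S"
  shows "((\<lambda>t. g (z + t *s v)) has_field_derivative (\<Sum>j\<in>UNIV. partial j g (z + t *s v) * v $ j)) (at t)"
  by (rule DERIV_line) (rule mholomorphic_onD[OF assms])

section \<open>Algebraic closure rules and the resulting partial derivatives\<close>

lemma mholomorphic_on_const: "(\<lambda>z. c) mholomorphic_on S"
  by (rule mholomorphic_onI[where c = "\<lambda>_ _. 0"]) simp

lemma mholomorphic_on_add:
  assumes "f mholomorphic_on S" "g mholomorphic_on S"
  shows "(\<lambda>z. f z + g z) mholomorphic_on S"
    and "\<And>z. z \<in> S \<Longrightarrow> partial i (\<lambda>z. f z + g z) z = partial i f z + partial i g z"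
proof -
  have *: "((\<lambda>z. f z + g z) has_derivative
      (\<lambda>v. \<Sum>j\<in>UNIV. (partial j f z + partial j g z) * v $ j)) (at z)" if "z \<in> S" for z
    by (rule has_derivative_eq_rhs[OF has_derivative_add[OF assms[THEN mholomorphic_onD, OF that]]])
       (simp add: algebra_simps sum.distrib)
  show "(\<lambda>z. f z + g z) mholomorphic_on S"
    by (rule mholomorphic_onI[OF *])
  show "\<And>z. z \<in> S \<Longrightarrow> partial i (\<lambda>z. f z + g z) z = partial i f z + partial i g z"
    by (rule partial_eqI[OF *])
qed

lemma mholomorphic_on_mult:
  assumes "f mholomorphic_on S" "g mholomorphic_on S"
  shows "(\<lambda>z. f z * g z) mholomorphic_on S"
    and "\<And>z. z \<in> S \<Longrightarrow> partial i (\<lambda>z. f z * g z) z = partial i f z * g z + f z * partial i g z"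
proof -
  have *: "((\<lambda>z. f z * g z) has_derivative
      (\<lambda>v. \<Sum>j\<in>UNIV. (partial j f z * g z + f z * partial j g z) * v $ j)) (at z)" if "z \<in> S" for z
    by (rule has_derivative_eq_rhs[OF has_derivative_mult[OF assms[THEN mholomorphic_onD, OF that]]])
       (simp add: algebra_simps sum.distrib sum_distrib_left)
  show "(\<lambda>z. f z * g z) mholomorphic_on S"
    by (rule mholomorphic_onI[OF *])
  show "\<And>z. z \<in> S \<Longrightarrow> partial i (\<lambda>z. f z * g z) z = partial i f z * g z + f z * partial i g z"
    by (rule partial_eqI[OF *])
qed

lemma mholomorphic_on_inverse:
  assumes "f mholomorphic_on S" "\<And>z. z \<in> S \<Longrightarrow> f z \<noteq> 0"
  shows "(\<lambda>z. inverse (f z)) mholomorphic_on S"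
    and "\<And>z. z \<in> S \<Longrightarrow> partial i (\<lambda>z. inverse (f z)) z = - partial i f z / (f z)\<^sup>2"
proof -
  have *: "((\<lambda>z. inverse (f z)) has_derivative
      (\<lambda>v. \<Sum>j\<in>UNIV. (- partial j f z / (f z)\<^sup>2) * v $ j)) (at z)" if "z \<in> S" for z
    by (rule has_derivative_eq_rhs[OF Deriv.has_derivative_inverse[OF assms(2)[OF that] mholomorphic_onD[OF assms(1) that]]])
       (simp add: fun_eq_iff power2_eq_square divide_inverse sum_distrib_left sum_negf algebra_simps)
  show "(\<lambda>z. inverse (f z)) mholomorphic_on S"
    by (rule mholomorphic_onI[OF *])
  show "\<And>z. z \<in> S \<Longrightarrow> partial i (\<lambda>z. inverse (f z)) z = - partial i f z / (f z)\<^sup>2"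
    by (rule partial_eqI[OF *])
qed

lemma partial_const: "partial i (\<lambda>z. c) z = 0"
  by (simp add: partial_def)

lemma partial_cmult:
  assumes "f mholomorphic_on S" "z \<in> S"
  shows "partial i (\<lambda>z. c * f z) z = c * partial i f z"
  using mholomorphic_on_mult(2)[OF mholomorphic_on_const assms, of i c] by (simp add: partial_const)

lemma mholomorphic_on_sum:
  assumes "\<And>a. a \<in> A \<Longrightarrow> f a mholomorphic_on S"
  shows "(\<lambda>z. \<Sum>a\<in>A. f a z) mholomorphic_on S"
    and "\<And>z. z \<in> S \<Longrightarrow> partial i (\<lambda>z. \<Sum>a\<in>A. f a z) z = (\<Sum>a\<in>A. partial i (f a) z)"
proof -
  have "(\<lambda>z. \<Sum>a\<in>A. f a z) mholomorphic_on S \<and>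
    (\<forall>z\<in>S. partial i (\<lambda>z. \<Sum>a\<in>A. f a z) z = (\<Sum>a\<in>A. partial i (f a) z))"
    using assms
  proof (induction A rule: infinite_finite_induct)
    case (insert a A)
    then have a: "f a mholomorphic_on S" and A: "(\<lambda>z. \<Sum>a\<in>A. f a z) mholomorphic_on S"
      by auto
    show ?case
      using mholomorphic_on_add[OF a A] insert by simp
  qed (simp_all add: mholomorphic_on_const partial_const)
  then show "(\<lambda>z. \<Sum>a\<in>A. f a z) mholomorphic_on S"
    and "\<And>z. z \<in> S \<Longrightarrow> partial i (\<lambda>z. \<Sum>a\<in>A. f a z) z = (\<Sum>a\<in>A. partial i (f a) z)"
    by auto
qed

lemma mholomorphic_on_prod:
  fixes f :: "'b \<Rightarrow> complex ^ 'n \<Rightarrow> complex"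
  assumes "\<And>a. a \<in> A \<Longrightarrow> f a mholomorphic_on S"
  shows "(\<lambda>z. \<Prod>a\<in>A. f a z) mholomorphic_on S"
    and "\<And>z. z \<in> S \<Longrightarrow> partial i (\<lambda>z. \<Prod>a\<in>A. f a z) z =
           (\<Sum>a\<in>A. partial i (f a) z * (\<Prod>b\<in>A - {a}. f b z))"
proof -
  have *: "((\<lambda>z. \<Prod>a\<in>A. f a z) has_derivative
      (\<lambda>v. \<Sum>j\<in>UNIV. (\<Sum>a\<in>A. partial j (f a) z * (\<Prod>b\<in>A - {a}. f b z)) * v $ j)) (at z)"
    if "z \<in> S" for z
  proof (rule has_derivative_eq_rhs[OF has_derivative_prod[OF mholomorphic_onD[OF assms that]]], assumption, rule ext)
    fix v :: "complex ^ 'n"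
    have "(\<Sum>a\<in>A. (\<Sum>j\<in>UNIV. partial j (f a) z * v $ j) * (\<Prod>b\<in>A - {a}. f b z)) =
        (\<Sum>a\<in>A. \<Sum>j\<in>UNIV. partial j (f a) z * (\<Prod>b\<in>A - {a}. f b z) * v $ j)"
      unfolding sum_distrib_right by (simp only: mult_ac)
    also have "\<dots> = (\<Sum>j\<in>UNIV. (\<Sum>a\<in>A. partial j (f a) z * (\<Prod>b\<in>A - {a}. f b z)) * v $ j)"
      by (subst sum.swap) (simp add: sum_distrib_right)
    finally show "(\<Sum>a\<in>A. (\<Sum>j\<in>UNIV. partial j (f a) z * v $ j) * (\<Prod>b\<in>A - {a}. f b z)) =
        (\<Sum>j\<in>UNIV. (\<Sum>a\<in>A. partial j (f a) z * (\<Prod>b\<in>A - {a}. f b z)) * v $ j)" .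
  qed
  show "(\<lambda>z. \<Prod>a\<in>A. f a z) mholomorphic_on S"
    by (rule mholomorphic_onI[OF *])
  show "\<And>z. z \<in> S \<Longrightarrow> partial i (\<lambda>z. \<Prod>a\<in>A. f a z) z =
           (\<Sum>a\<in>A. partial i (f a) z * (\<Prod>b\<in>A - {a}. f b z))"
    by (rule partial_eqI[OF *])
qed

lemma mholomorphic_on_cong:
  assumes "open S" "f mholomorphic_on S" "\<And>z. z \<in> S \<Longrightarrow> f z = g z"
  shows "g mholomorphic_on S"
  by (rule mholomorphic_onI, rule has_derivative_transform_within_open[OF mholomorphic_onD[OF assms(2)] assms(1)])
     (use assms(3) in auto)

lemma partial_cong:
  assumes "open S" "f mholomorphic_on S" "\<And>z. z \<in> S \<Longrightarrow> f z = g z" "z \<in> S"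
  shows "partial i f z = partial i g z"
  by (rule partial_eqI[symmetric], rule has_derivative_transform_within_open[OF mholomorphic_onD[OF assms(2)] assms(1)])
     (use assms(3,4) in auto)

section \<open>Cauchy's formula and smoothness of the partial derivatives\<close>

lemma Cauchy_deriv_mean:
  fixes h :: "complex \<Rightarrow> complex"
  assumes h: "\<And>x. x \<in> cball 0 r \<Longrightarrow> h field_differentiable (at x)" and r: "0 < r"
  shows "deriv h 0 = integral {0..1} (\<lambda>t. h (of_real r * exp (2 * of_real pi * \<i> * of_real t)) /
           (of_real r * exp (2 * of_real pi * \<i> * of_real t)))"
proof -
  have c: "continuous_on (cball 0 r) h"
    by (meson continuous_at_imp_continuous_on field_differentiable_imp_continuous_at h)
  have hol: "h holomorphic_on ball 0 r"
    by (auto simp: holomorphic_on_def intro!: field_differentiable_at_within[OF h])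
  have "deriv h 0 = 1 / (2 * of_real pi * \<i>) * contour_integral (circlepath 0 r) (\<lambda>u. h u / (u - 0)^2)"
    by (rule DERIV_imp_deriv, rule Cauchy_derivative_integral_circlepath(2)[OF c hol]) (use r in auto)
  also have "\<dots> = integral {0..1} (\<lambda>t. h (of_real r * exp (2 * of_real pi * \<i> * of_real t)) /
           (of_real r * exp (2 * of_real pi * \<i> * of_real t)))"
    unfolding contour_integral_integral integral_mult_right[symmetric]
  proof (rule integral_cong)
    fix t :: real assume t: "t \<in> {0..1}"
    have "vector_derivative (circlepath 0 r) (at t) = 2 * of_real pi * \<i> * of_real r * exp (2 * of_real pi * \<i> * of_real t)"
      by (simp add: vector_derivative_circlepath)
    then show "1 / (2 * of_real pi * \<i>) * (h (circlepath 0 r t) / (circlepath 0 r t - 0)\<^sup>2 *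
        vector_derivative (circlepath 0 r) (at t)) =
      h (of_real r * exp (2 * of_real pi * \<i> * of_real t)) / (of_real r * exp (2 * of_real pi * \<i> * of_real t))"
      using r by (simp add: circlepath field_simps power2_eq_square)
  qed
  finally show ?thesis .
qed

lemma norm_smult_axis: "norm (x *s axis i (1::complex)) = norm x"
proof -
  have "(\<Sum>j\<in>UNIV. (cmod (axis i x $ j))\<^sup>2) = (\<Sum>j\<in>UNIV. if j = i then (cmod x)\<^sup>2 else 0)"
    by (intro sum.cong) (auto simp: axis_def)
  then show ?thesis
    by (simp add: smult_axis norm_vec_def L2_set_def)
qed

text \<open>Cauchy's formula on a circle in the \<open>i\<close>-th coordinate direction. The
  integral runs over a fixed real interval and \<open>z\<close> enters only through the integrand,
  so theorems on parameter integrals apply.\<close>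

lemma partial_mean:
  fixes g :: "complex ^ 'n \<Rightarrow> complex"
  assumes g: "g mholomorphic_on S" and r: "0 < r"
    and S: "\<And>x. norm x \<le> r \<Longrightarrow> z + x *s axis i 1 \<in> S"
  shows "partial i g z = integral {0..1} (\<lambda>t.
      g (z + (of_real r * exp (2 * of_real pi * \<i> * of_real t)) *s axis i 1) /
        (of_real r * exp (2 * of_real pi * \<i> * of_real t)))"
  unfolding partial_eq_deriv_line
  by (rule Cauchy_deriv_mean[OF _ r])
     (auto simp: field_differentiable_def intro!: exI mholomorphic_DERIV_line[OF g] S)

text \<open>Near \<open>z0\<close> one radius \<open>r\<close> serves all \<open>z\<close>, so the
  partial derivative is a parameter integral with continuous integrand.
  \<open>partial_mholomorphic\<close> uses this continuity to differentiate under the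
  integral.\<close>

lemma continuous_on_partial:
  fixes g :: "complex ^ 'n \<Rightarrow> complex"
  assumes g: "g mholomorphic_on S" and S: "open S"
  shows "continuous_on S (partial i g)"
proof (rule continuous_at_imp_continuous_on, rule ballI)
  fix z0 assume "z0 \<in> S"
  then obtain e where e: "0 < e" "ball z0 e \<subseteq> S"
    using S openE by blast
  \<comment> \<open>Half of \<open>e\<close>, so that circles of radius \<open>r\<close> about
    points of \<open>ball z0 r\<close> stay inside \<open>ball z0 e\<close>.\<close>
  define r where "r = e / 2"
  have r: "0 < r" using e by (simp add: r_def)
  have in_S: "z + x *s axis i 1 \<in> S" if "z \<in> ball z0 r" "norm x \<le> r" for z x
  proof -
    have "dist z0 (z + x *s axis i 1) \<le> dist z0 z + norm (x *s axis i 1)"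
      by (metis dist_norm dist_triangle add_diff_cancel_left' dist_commute)
    then show ?thesis
      using that e by (auto simp: norm_smult_axis r_def intro!: subsetD[OF e(2)])
  qed
  have "continuous_on (ball z0 r) (\<lambda>z. integral (cbox 0 1) (\<lambda>t::real.
      g (z + (of_real r * exp (2 * of_real pi * \<i> * of_real t)) *s axis i 1) /
        (of_real r * exp (2 * of_real pi * \<i> * of_real t))))"
    by (rule integral_continuous_on_param)
       (use r in \<open>auto simp: split_beta norm_mult intro!: continuous_intros in_S
          continuous_on_compose2[OF mholomorphic_on_imp_continuous_on[OF g]]\<close>)
  then have "continuous_on (ball z0 r) (partial i g)"
    by (rule continuous_on_eq) (use partial_mean[OF g r in_S] in \<open>auto simp: cbox_interval\<close>)
  then show "isCont (partial i g) z0"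
    using r by (simp add: continuous_on_eq_continuous_at)
qed

text \<open>Both claims follow by differentiating the Cauchy integral of \<open>partial_mean\<close> under the integral.\<close>

lemma partial_mholomorphic:
  fixes g :: "complex ^ 'n \<Rightarrow> complex"
  assumes g: "g mholomorphic_on S" and S: "open S"
  shows "partial i g mholomorphic_on S"
    and "\<And>z. z \<in> S \<Longrightarrow> partial j (partial i g) z = partial i (partial j g) z"
proof -
  define E :: "real \<Rightarrow> complex" where "E = (\<lambda>t. exp (2 * of_real pi * \<i> * of_real t))"
  have cE[continuous_intros]: "continuous_on A f \<Longrightarrow> continuous_on A (\<lambda>x. E (f x))" for A :: "'z::topological_space set" and f
    unfolding E_def by (intro continuous_intros)
  have E[simp]: "norm (E t) = 1" "E t \<noteq> 0" for t
    by (simp_all add: E_def)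
  \<comment> \<open>The coefficients are recorded as Cauchy integrals of \<open>partial k g\<close>;
    the symmetry of mixed derivatives is read off from this form.\<close>
  have main: "\<exists>c. (partial i g has_derivative (\<lambda>v. \<Sum>k\<in>UNIV. c k * v $ k)) (at z0) \<and>
    (\<exists>r>0. (\<forall>x. norm x \<le> r \<longrightarrow> z0 + x *s axis i 1 \<in> S) \<and>
      (\<forall>k. c k = integral {0..1} (\<lambda>t. partial k g (z0 + (of_real r * E t) *s axis i 1) / (of_real r * E t))))"
    if z0: "z0 \<in> S" for z0 i
  proof -
    obtain e where e: "0 < e" "ball z0 e \<subseteq> S"
      using S z0 openE by blast
    define r where "r = e / 2"
    have r: "0 < r" using e by (simp add: r_def)
    have in_S: "z + x *s axis i 1 \<in> S" if "z \<in> ball z0 r" "norm x \<le> r" for z x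
    proof -
      have "dist z0 (z + x *s axis i 1) \<le> dist z0 z + norm (x *s axis i 1)"
        by (metis dist_norm dist_triangle add_diff_cancel_left' dist_commute)
      then show ?thesis
        using that e by (auto simp: norm_smult_axis r_def intro!: subsetD[OF e(2)])
    qed
    define P where "P = (\<lambda>z t. z + (of_real r * E t) *s axis i (1::complex))"
    have P: "P z t \<in> S" if "z \<in> ball z0 r" for z t
      unfolding P_def using r that by (intro in_S) (auto simp: norm_mult)
    have cP: "continuous_on A (\<lambda>x. P (fst x) (snd x))" for A
      unfolding P_def by (intro continuous_intros)
    \<comment> \<open>\<open>leibniz_rule\<close> takes the derivative of the integrand as a bounded
      linear function, hence the \<open>Blinfun\<close> wrapper.\<close>
    define D where "D = (\<lambda>z t. Blinfun (\<lambda>v. (\<Sum>k\<in>UNIV. partial k g (P z t) * v $ k) / (of_real r * E t)))"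
    have D: "blinfun_apply (D z t) = (\<lambda>v. (\<Sum>k\<in>UNIV. partial k g (P z t) * v $ k) / (of_real r * E t))" for z t
      unfolding D_def
      by (rule bounded_linear_Blinfun_apply)
         (auto intro!: bounded_linear_divide[THEN bounded_linear_compose] bounded_linear_sum
           bounded_linear_mult_right[THEN bounded_linear_compose] bounded_linear_vec_nth)
    have cD: "continuous_on (ball z0 r \<times> cbox 0 1) (\<lambda>(z, t). D z t)"
      unfolding split_beta
      by (rule continuous_on_blinfun_componentwise)
         (use r P in \<open>auto simp: D intro!: continuous_intros cP
            continuous_on_compose2[OF continuous_on_partial[OF g S] cP]\<close>)
    have "((\<lambda>z. integral (cbox 0 1) (\<lambda>t. g (P z t) / (of_real r * E t)))
        has_derivative integral (cbox 0 1) (D z0)) (at z0 within ball z0 r)"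
    proof (rule leibniz_rule[OF _ _ cD])
      fix z t assume z: "z \<in> ball z0 r"
      have "((\<lambda>z. P z t) has_derivative (\<lambda>v. v)) (at z within ball z0 r)"
        unfolding P_def by (auto intro!: derivative_eq_intros)
      from has_derivative_compose[OF this mholomorphic_onD[OF g P[OF z]]]
      have "((\<lambda>z. g (P z t)) has_derivative (\<lambda>v. \<Sum>k\<in>UNIV. partial k g (P z t) * v $ k)) (at z within ball z0 r)" .
      from has_derivative_compose[OF this bounded_linear_imp_has_derivative[OF bounded_linear_divide]]
      show "((\<lambda>z. g (P z t) / (of_real r * E t)) has_derivative blinfun_apply (D z t)) (at z within ball z0 r)"
        unfolding D .
    next
      fix z assume z: "z \<in> ball z0 r"
      have "continuous_on (cbox 0 1) (\<lambda>t. P z t)"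
        unfolding P_def by (intro continuous_intros)
      then show "(\<lambda>t. g (P z t) / (of_real r * E t)) integrable_on cbox 0 1"
        by (intro integrable_continuous continuous_intros 
            continuous_on_compose2[OF mholomorphic_on_imp_continuous_on[OF g]])
           (use r P z in auto)
    qed (use r in auto)
    then have *: "(partial i g has_derivative integral (cbox 0 1) (D z0)) (at z0)"
    proof (subst (asm) at_within_open[of _ "ball z0 r"], goal_cases)
      case 3
      show ?case
        by (rule has_derivative_transform_within_open[OF 3, of "ball z0 r"])
           (use r partial_mean[OF g r in_S] in \<open>auto simp: E_def P_def cbox_interval\<close>)
    qed (use r in auto)
    define c where "c k = integral {0..1} (\<lambda>t. partial k g (z0 + (of_real r * E t) *s axis i 1) / (of_real r * E t))" for k
    have cP0: "continuous_on (cbox 0 1) (P z0)"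
      unfolding P_def by (intro continuous_intros)
    have int: "D z0 integrable_on cbox 0 1"
      by (rule integrable_continuous, rule continuous_on_blinfun_componentwise)
         (use r P cP0 in \<open>auto simp: D intro!: continuous_intros
            continuous_on_compose2[OF continuous_on_partial[OF g S]]\<close>)
    have "blinfun_apply (integral (cbox 0 1) (D z0)) v = (\<Sum>k\<in>UNIV. c k * v $ k)" for v
    proof -
      have "blinfun_apply (integral (cbox 0 1) (D z0)) v = integral (cbox 0 1) (\<lambda>t. blinfun_apply (D z0 t) v)"
        by (rule blinfun_apply_integral[OF int])
      also have "\<dots> = integral (cbox 0 1) (\<lambda>t. \<Sum>k\<in>UNIV. partial k g (P z0 t) / (of_real r * E t) * v $ k)"
        by (simp add: D sum_divide_distrib)
      also have "\<dots> = (\<Sum>k\<in>UNIV. integral (cbox 0 1) (\<lambda>t. partial k g (P z0 t) / (of_real r * E t) * v $ k))"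
        by (rule integral_sum)
           (use r P cP0 in \<open>auto intro!: integrable_continuous_interval continuous_intros
              continuous_on_compose2[OF continuous_on_partial[OF g S]]\<close>)
      also have "\<dots> = (\<Sum>k\<in>UNIV. c k * v $ k)"
        by (simp only: c_def P_def cbox_interval integral_mult_left)
      finally show ?thesis .
    qed
    then have "blinfun_apply (integral (cbox 0 1) (D z0)) = (\<lambda>v. \<Sum>k\<in>UNIV. c k * v $ k)"
      by (rule ext)
    with * have "(partial i g has_derivative (\<lambda>v. \<Sum>k\<in>UNIV. c k * v $ k)) (at z0)"
      by simp
    then show ?thesis
      using r in_S[of z0] unfolding c_def by (intro exI[of _ c] conjI exI[of _ r]) (auto simp: c_def)
  qed
  show hol: "partial i g mholomorphic_on S" for i
  unfolding mholomorphic_on_def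
  proof
    fix z assume "z \<in> S"
    then obtain c where c: "(partial i g has_derivative (\<lambda>v. \<Sum>k\<in>UNIV. c k * v $ k)) (at z)"
      using main[of z i] by blast
    show "(partial i g has_derivative (\<lambda>v. \<Sum>j\<in>UNIV. partial j (partial i g) z * v $ j)) (at z)"
      using c unfolding partial_eqI[OF c] .
  qed
  fix z assume z: "z \<in> S"
  obtain c r where cr: "(partial i g has_derivative (\<lambda>v. \<Sum>k\<in>UNIV. c k * v $ k)) (at z)" "r > 0"
     "\<And>x. norm x \<le> r \<Longrightarrow> z + x *s axis i 1 \<in> S"
     "\<And>k. c k = integral {0..1} (\<lambda>t. partial k g (z + (of_real r * E t) *s axis i 1) / (of_real r * E t))"
    using main[OF z, of i] by auto
  have "partial j (partial i g) z = c j"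
    by (rule partial_eqI[OF cr(1)])
  \<comment> \<open>Now that \<open>partial j g\<close> is known to be holomorphic, the integral for
    \<open>c j\<close> is its own Cauchy formula in direction \<open>i\<close>.\<close>
  also have "\<dots> = partial i (partial j g) z"
    using partial_mean[OF hol[of j] cr(2,3)] cr(4)[of j] by (simp add: E_def)
  finally show "partial j (partial i g) z = partial i (partial j g) z" .
qed

section \<open>Nonvanishing solutions of linear systems\<close>

text \<open>Brouwer's theorem takes the place of Rouche's: zeros of \<open>\<phi>\<close> are the
  fixed points of \<open>t - \<phi> t / A\<close>, and the error bound \<open>A * \<rho> - 1\<close>
  is what makes this map send the disc into itself.\<close>

lemma perturbed_affine_has_zero:
  fixes \<phi> :: "complex \<Rightarrow> complex"
  assumes cont: "continuous_on (cball 0 \<rho>) \<phi>" and A: "A > 0" and \<rho>: "\<rho> > 0"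
    and E: "\<And>t. t \<in> cball 0 \<rho> \<Longrightarrow> norm (\<phi> t - 1 - of_real A * t) \<le> A * \<rho> - 1"
  obtains t where "t \<in> cball 0 \<rho>" "\<phi> t = 0"
proof -
  define T where "T = (\<lambda>t. t - \<phi> t / of_real A)"
  have "continuous_on (cball 0 \<rho>) T"
    unfolding T_def using A by (intro continuous_intros cont) auto
  moreover have "T \<in> cball 0 \<rho> \<rightarrow> cball 0 \<rho>"
  proof
    fix t :: complex assume t: "t \<in> cball 0 \<rho>"
    have "T t = - (1 + (\<phi> t - 1 - of_real A * t)) / of_real A"
      using A by (simp add: T_def field_simps)
    then have "norm (T t) = norm (1 + (\<phi> t - 1 - of_real A * t)) / A"
      using A by (simp add: norm_divide norm_minus_commute)
    also have "\<dots> \<le> (1 + (A * \<rho> - 1)) / A"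
      using A E[OF t] norm_triangle_ineq[of 1 "\<phi> t - 1 - of_real A * t"]
      by (intro divide_right_mono) auto
    also have "\<dots> = \<rho>" using A by simp
    finally show "T t \<in> cball 0 \<rho>" by simp
  qed
  ultimately obtain t where "t \<in> cball 0 \<rho>" "T t = t"
    using brouwer[OF compact_cball convex_cball _ _, of 0 \<rho> T] \<rho> by (metis cball_eq_empty less_asym)
  then show thesis
    using that[of t] A by (simp add: T_def)
qed

text \<open>On a disc whose radius is small compared to the inverse of the size of the coefficients, \<open>\<phi>\<close> is
  a small perturbation of \<open>1 + A t\<close>, which would have a zero there if \<open>A\<close> were larger.\<close>

lemma linear_system_slope_bound:
  fixes w :: "'n::finite \<Rightarrow> complex \<Rightarrow> complex" and \<phi> :: "complex \<Rightarrow> complex"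
    and P :: "'n \<Rightarrow> 'n \<Rightarrow> complex \<Rightarrow> complex" and Q :: "'n \<Rightarrow> complex \<Rightarrow> complex"
  assumes \<phi>: "\<And>t. norm t \<le> \<rho> \<Longrightarrow> (\<phi> has_field_derivative (\<Sum>j\<in>UNIV. \<zeta> j * w j t)) (at t)"
    and w: "\<And>i t. norm t \<le> \<rho> \<Longrightarrow>
          (w i has_field_derivative (\<Sum>k\<in>UNIV. P i k t * w k t) + Q i t * \<phi> t) (at t)"
    and \<phi>0: "\<phi> 0 = 1" and nz: "\<And>t. norm t \<le> \<rho> \<Longrightarrow> \<phi> t \<noteq> 0"
    and \<zeta>: "\<And>j. norm (\<zeta> j) \<le> 1"
    and slope: "(\<Sum>j\<in>UNIV. \<zeta> j * w j 0) = of_real A" and A: "\<And>j. norm (w j 0) \<le> A"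
    and PQ: "\<And>i k t. norm t \<le> \<rho> \<Longrightarrow> norm (P i k t) \<le> p"
            "\<And>i t. norm t \<le> \<rho> \<Longrightarrow> norm (Q i t) \<le> q"
    and \<rho>: "0 < \<rho>" "\<rho> \<le> 1" and pos: "0 \<le> \<alpha>" "\<rho> * \<alpha> \<le> 1"
    and small: "\<rho> * (real CARD('n) * p) \<le> \<epsilon>" "\<rho> * (real CARD('n) * q) \<le> \<epsilon> * (1 + \<alpha>)"
    and \<epsilon>: "\<epsilon> = 1 / (30 * real CARD('n))"
  shows "A \<le> 3 / (2 * \<rho>)"
proof (rule ccontr)
  assume "\<not> A \<le> 3 / (2 * \<rho>)"
  then have A\<rho>: "A * \<rho> > 3 / 2"
    using \<rho> by (auto simp: field_simps)
  then have A0: "A > 0"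
    using \<rho>(1) zero_less_mult_pos2[of A \<rho>] by auto
  define n where "n = real CARD('n)"
  have n: "n \<ge> 1" unfolding n_def using card_gt_0_iff[of "UNIV :: 'n set"] by (simp add: Suc_le_eq)
  have \<epsilon>n: "\<epsilon> * n = 1 / 30" "0 < \<epsilon>" "\<epsilon> \<le> 1 / 30"
    using n by (auto simp: \<epsilon> n_def[symmetric] field_simps)
  have cw: "continuous_on (cball 0 \<rho>) (w i)" for i
    by (rule continuous_at_imp_continuous_on) (auto intro!: DERIV_isCont w)
  have c\<phi>: "continuous_on (cball 0 \<rho>) \<phi>"
    by (rule continuous_at_imp_continuous_on) (auto intro!: DERIV_isCont \<phi>)
  \<comment> \<open>The maxima \<open>M\<close> of \<open>W t\<close> and \<open>N\<close> of
    \<open>norm (\<phi> t)\<close> over the disc are bounded in terms of each other, which replaces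
    a Gronwall argument.\<close>
  define W where "W t = (\<Sum>i\<in>UNIV. norm (w i t))" for t
  have cW: "continuous_on (cball 0 \<rho>) W"
    unfolding W_def by (intro continuous_intros cw)
  obtain t1 where t1: "t1 \<in> cball 0 \<rho>" "\<And>t. t \<in> cball 0 \<rho> \<Longrightarrow> W t \<le> W t1"
    using continuous_attains_sup[OF compact_cball _ cW] \<rho> by (auto simp del: mem_cball)
  obtain t2 where t2: "t2 \<in> cball 0 \<rho>" "\<And>t. t \<in> cball 0 \<rho> \<Longrightarrow> norm (\<phi> t) \<le> norm (\<phi> t2)"
    using continuous_attains_sup[OF compact_cball _ continuous_on_norm[OF c\<phi>]] \<rho> by (auto simp del: mem_cball)
  define M where "M = W t1"
  define N where "N = norm (\<phi> t2)"
  have M: "W t \<le> M" if "norm t \<le> \<rho>" for t using t1 that by (simp add: M_def)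
  have N: "norm (\<phi> t) \<le> N" if "norm t \<le> \<rho>" for t using t2 that by (simp add: N_def)
  have M0: "0 \<le> M" unfolding M_def W_def by (intro sum_nonneg) auto
  have N0: "0 \<le> N" by (simp add: N_def)
  have p0: "0 \<le> p" using PQ(1)[of 0] \<rho> order_trans[OF norm_ge_zero] by force
  have q0: "0 \<le> q" using PQ(2)[of 0] \<rho> order_trans[OF norm_ge_zero] by force
  have incr: "norm (g t - g 0) \<le> B * \<rho>"
    if g: "\<And>t. norm t \<le> \<rho> \<Longrightarrow> (g has_field_derivative g' t) (at t)" "\<And>t. norm t \<le> \<rho> \<Longrightarrow> norm (g' t) \<le> B"
      and t: "norm t \<le> \<rho>" for g g' :: "complex \<Rightarrow> complex" and B t
  proof -
    have "0 \<le> B" using g(2)[of 0] \<rho> order_trans[OF norm_ge_zero] by force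
    have "norm (g t - g 0) \<le> B * norm (t - 0)"
      by (rule field_differentiable_bound[of "cball 0 \<rho>" g g'])
         (use g t \<rho> in \<open>auto intro: has_field_derivative_at_within\<close>)
    also have "\<dots> \<le> B * \<rho>" using t \<open>0 \<le> B\<close> by (auto intro: mult_left_mono)
    finally show ?thesis .
  qed
  have \<phi>'_bd: "norm (\<Sum>j\<in>UNIV. \<zeta> j * w j t) \<le> M" if "norm t \<le> \<rho>" for t
  proof -
    have "norm (\<Sum>j\<in>UNIV. \<zeta> j * w j t) \<le> (\<Sum>j\<in>UNIV. 1 * norm (w j t))"
      by (rule sum_norm_le) (unfold norm_mult, intro mult_right_mono \<zeta> norm_ge_zero)
    then show ?thesis using M[OF that] by (simp add: W_def)
  qed
  have N_le: "N \<le> 1 + \<rho> * M"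
  proof -
    have "norm (\<phi> t2 - \<phi> 0) \<le> M * \<rho>"
      by (rule incr[OF \<phi> \<phi>'_bd]) (use t2 in auto)
    then show ?thesis
      using norm_triangle_ineq[of "\<phi> t2 - 1" 1] by (simp add: N_def \<phi>0 mult.commute)
  qed
  have w'_bd: "norm ((\<Sum>k\<in>UNIV. P i k t * w k t) + Q i t * \<phi> t) \<le> p * M + q * N" if t: "norm t \<le> \<rho>" for i t
  proof -
    have "norm (\<Sum>k\<in>UNIV. P i k t * w k t) \<le> (\<Sum>k\<in>UNIV. p * norm (w k t))"
      by (rule sum_norm_le) (unfold norm_mult, intro mult_right_mono PQ t norm_ge_zero)
    also have "\<dots> \<le> p * M"
      using M[OF t] p0 by (simp add: W_def sum_distrib_left[symmetric] mult_left_mono)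
    finally have "norm (\<Sum>k\<in>UNIV. P i k t * w k t) \<le> p * M" .
    moreover have "norm (Q i t * \<phi> t) \<le> q * N"
      unfolding norm_mult by (intro mult_mono PQ N t q0) auto
    ultimately show ?thesis by (meson add_mono norm_triangle_le)
  qed
  have w_bd: "norm (w i t - w i 0) \<le> (p * M + q * N) * \<rho>" if "norm t \<le> \<rho>" for i t
    by (rule incr[OF w w'_bd that])
  \<comment> \<open>Bounds the sum over all \<open>i\<close> of the changes of \<open>w i\<close>
    across the disc.\<close>
  define \<delta> where "\<delta> = n * ((p * M + q * N) * \<rho>)"
  have \<delta>: "\<delta> \<le> 3 * \<epsilon> * M + \<epsilon> * (1 + \<alpha>)"
  proof -
    have "\<delta> = \<rho> * (n * p) * M + \<rho> * (n * q) * N" by (simp add: \<delta>_def algebra_simps)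
    also have "\<dots> \<le> \<epsilon> * M + \<epsilon> * (1 + \<alpha>) * N"
      using small M0 N0 unfolding n_def[symmetric] by (intro add_mono mult_right_mono)
    also have "\<epsilon> * (1 + \<alpha>) * N \<le> \<epsilon> * (1 + \<alpha>) * (1 + \<rho> * M)"
      using N_le pos \<epsilon>n by (intro mult_left_mono) auto
    also have "\<epsilon> * (1 + \<alpha>) * (1 + \<rho> * M) = \<epsilon> * (1 + \<alpha>) + \<epsilon> * ((\<rho> + \<rho> * \<alpha>) * M)"
      by (simp add: algebra_simps)
    also have "(\<rho> + \<rho> * \<alpha>) * M \<le> 2 * M"
      using \<rho> pos M0 by (intro mult_right_mono) auto
    finally show ?thesis using \<epsilon>n by (simp add: algebra_simps)
  qed
  have M_le: "M \<le> 2 * n * A + 2 * \<epsilon> * (1 + \<alpha>)"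
  proof -
    have "(\<Sum>i\<in>UNIV. norm (w i t1)) \<le> (\<Sum>i\<in>(UNIV :: 'n set). A + (p * M + q * N) * \<rho>)"
    proof (rule sum_mono)
      fix i
      show "norm (w i t1) \<le> A + (p * M + q * N) * \<rho>"
        using norm_triangle_ineq[of "w i 0" "w i t1 - w i 0"] A[of i] w_bd[of t1 i] t1(1) by simp
    qed
    then have "M \<le> n * A + \<delta>"
      by (simp add: n_def \<delta>_def M_def[unfolded W_def, symmetric] algebra_simps)
    also have "\<dots> \<le> n * A + (3 * \<epsilon> * M + \<epsilon> * (1 + \<alpha>))" using \<delta> by simp
    finally have "M * (1 - 3 * \<epsilon>) \<le> n * A + \<epsilon> * (1 + \<alpha>)" by (simp add: algebra_simps)
    \<comment> \<open>Since \<open>3 * \<epsilon>\<close> is at most 1/10, the \<open>M\<close> term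
      on the right can be absorbed on the left.\<close>
    moreover have "M * (1 / 2) \<le> M * (1 - 3 * \<epsilon>)"
      using M0 \<epsilon>n by (intro mult_left_mono) auto
    ultimately show ?thesis by (simp add: algebra_simps)
  qed
  have E_bd: "norm (\<phi> t - 1 - of_real A * t) \<le> A * \<rho> - 1" if t: "norm t \<le> \<rho>" for t
  proof -
    \<comment> \<open>Without its linear part, \<open>\<phi>\<close> has as derivative the
      combination of the changes \<open>w j t - w j 0\<close> with weights \<open>\<zeta> j\<close>,
      which \<open>\<delta>\<close> controls.\<close>
    define g where "g t = \<phi> t - of_real A * t" for t
    have "norm (g t - g 0) \<le> \<delta> * \<rho>"
    proof (rule incr[OF _ _ t])
      fix t :: complex assume t: "norm t \<le> \<rho>"
      show "(g has_field_derivative (\<Sum>j\<in>UNIV. \<zeta> j * w j t) - of_real A) (at t)"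
        unfolding g_def by (auto intro!: derivative_eq_intros \<phi>[OF t])
      have "(\<Sum>j\<in>UNIV. \<zeta> j * w j t) - of_real A = (\<Sum>j\<in>UNIV. \<zeta> j * (w j t - w j 0))"
        by (simp add: slope[symmetric] algebra_simps sum_subtractf)
      also have "norm \<dots> \<le> (\<Sum>j\<in>(UNIV :: 'n set). 1 * ((p * M + q * N) * \<rho>))"
        by (rule sum_norm_le) (unfold norm_mult, intro mult_mono \<zeta> w_bd t, auto)
      finally show "norm ((\<Sum>j\<in>UNIV. \<zeta> j * w j t) - of_real A) \<le> \<delta>"
        by (simp add: \<delta>_def n_def)
    qed
    then have "norm (\<phi> t - 1 - of_real A * t) \<le> \<delta> * \<rho>"
      by (simp add: g_def \<phi>0 algebra_simps)
    also have "\<dots> \<le> (3 * \<epsilon> * M + \<epsilon> * (1 + \<alpha>)) * \<rho>"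
      using \<delta> \<rho> by (intro mult_right_mono) auto
    also have "\<dots> \<le> (3 * \<epsilon> * (2 * n * A + 2 * \<epsilon> * (1 + \<alpha>)) + \<epsilon> * (1 + \<alpha>)) * \<rho>"
      using M_le \<rho> \<epsilon>n by (intro mult_right_mono add_right_mono mult_left_mono) auto
    also have "\<dots> = 6 * (\<epsilon> * n) * (A * \<rho>) + (6 * \<epsilon>\<^sup>2 + \<epsilon>) * (\<rho> + \<rho> * \<alpha>)"
      by (simp add: algebra_simps power2_eq_square)
    also have "\<dots> \<le> 6 * (1 / 30) * (A * \<rho>) + (6 * \<epsilon>\<^sup>2 + \<epsilon>) * 2"
      unfolding \<epsilon>n using \<rho> pos \<epsilon>n A0 by (intro add_mono mult_left_mono) auto
    also have "\<epsilon>\<^sup>2 \<le> (1 / 30)\<^sup>2" using \<epsilon>n by (intro power_mono) auto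
    \<comment> \<open>The error is now at most \<open>A * \<rho> / 5 + 2 / 25\<close>, which lies
      below \<open>A * \<rho> - 1\<close> because \<open>A * \<rho> > 3 / 2\<close>.\<close>
    finally show ?thesis using A\<rho> \<epsilon>n by (simp add: power2_eq_square)
  qed
  obtain t where "t \<in> cball 0 \<rho>" "\<phi> t = 0"
    by (rule perturbed_affine_has_zero[OF c\<phi> A0 \<rho>(1)]) (use E_bd in auto)
  with nz show False by auto
qed

section \<open>The projective connection of a locally biholomorphic map\<close>

lemma mholomorphic_on_det:
  fixes A :: "complex ^ 'n \<Rightarrow> complex ^ 'n ^ 'n"
  assumes "\<And>a b. (\<lambda>z. A z $ a $ b) mholomorphic_on S"
  shows "(\<lambda>z. det (A z)) mholomorphic_on S"
  unfolding det_def
  by (intro mholomorphic_on_sum(1) mholomorphic_on_mult(1) mholomorphic_on_const mholomorphic_on_prod(1) assms)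

text \<open>In the Leibniz expansion a permutation other than the identity moves at least two
  indices. Differentiating one factor therefore leaves an off-diagonal zero of the identity matrix,
  and only the diagonal product contributes.\<close>

lemma partial_det_at_mat_1:
  fixes A :: "complex ^ 'n \<Rightarrow> complex ^ 'n ^ 'n"
  assumes A: "\<And>a b. (\<lambda>z. A z $ a $ b) mholomorphic_on S" and z: "z \<in> S" "A z = mat 1"
  shows "partial i (\<lambda>x. det (A x)) z = (\<Sum>a\<in>UNIV. partial i (\<lambda>x. A x $ a $ a) z)"
proof -
  let ?P = "{p. p permutes (UNIV :: 'n set)}"
  let ?T = "\<lambda>p. of_int (sign p) * (\<Sum>a\<in>UNIV. partial i (\<lambda>x. A x $ a $ p a) z * (\<Prod>b\<in>UNIV - {a}. A z $ b $ p b))"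
  have "partial i (\<lambda>x. det (A x)) z = (\<Sum>p\<in>?P. partial i (\<lambda>x. of_int (sign p) * (\<Prod>a\<in>UNIV. A x $ a $ p a)) z)"
    unfolding det_def
    by (rule mholomorphic_on_sum(2)[OF _ z(1)])
       (intro mholomorphic_on_mult(1) mholomorphic_on_const mholomorphic_on_prod(1) A)
  also have "\<dots> = (\<Sum>p\<in>?P. ?T p)"
  proof (rule sum.cong[OF refl])
    fix p :: "'n \<Rightarrow> 'n"
    have "partial i (\<lambda>x. of_int (sign p) * (\<Prod>a\<in>UNIV. A x $ a $ p a)) z =
      of_int (sign p) * partial i (\<lambda>x. \<Prod>a\<in>UNIV. A x $ a $ p a) z"
      by (rule partial_cmult[OF mholomorphic_on_prod(1) z(1)]) (rule A)
    also have "partial i (\<lambda>x. \<Prod>a\<in>UNIV. A x $ a $ p a) z =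
      (\<Sum>a\<in>UNIV. partial i (\<lambda>x. A x $ a $ p a) z * (\<Prod>b\<in>UNIV - {a}. A z $ b $ p b))"
      by (rule mholomorphic_on_prod(2)[OF _ z(1)]) (rule A)
    finally show "partial i (\<lambda>x. of_int (sign p) * (\<Prod>a\<in>UNIV. A x $ a $ p a)) z = ?T p" .
  qed
  also have "\<dots> = ?T id + (\<Sum>p\<in>?P - {id}. ?T p)"
    by (rule sum.remove) (simp_all add: finite_permutations permutes_id)
  also have "(\<Sum>p\<in>?P - {id}. ?T p) = 0"
  proof (rule sum.neutral, rule ballI)
    fix p assume p: "p \<in> ?P - {id}"
    have "(\<Prod>b\<in>UNIV - {a}. A z $ b $ p b) = 0" for a
    proof -
      obtain c where c: "p c \<noteq> c" using p by (auto simp: fun_eq_iff)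
      have inj: "inj p" using p permutes_inj by blast
      \<comment> \<open>If the moved point found is the differentiated index itself, its image is a
        second moved point by injectivity.\<close>
      have "\<exists>b. b \<noteq> a \<and> b \<noteq> p b"
      proof (cases "c = a")
        case True
        then show ?thesis using c inj by (intro exI[of _ "p a"]) (auto dest!: injD)
      qed (use c in metis)
      then show ?thesis
        by (intro prod_zero) (auto simp: z(2) mat_def)
    qed
    then show "?T p = 0" by (simp only: mult_zero_right sum.neutral_const)
  qed
  also have "?T id = (\<Sum>a\<in>UNIV. partial i (\<lambda>x. A x $ a $ a) z)"
    by (simp add: z(2) mat_def)
  finally show ?thesis by simp
qed

lemma matrix_inv_inverse:
  fixes A :: "'a::semiring_1 ^ 'n ^ 'm"
  assumes "invertible A"
  shows "A ** matrix_inv A = mat 1" and "matrix_inv A ** A = mat 1"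
  using someI_ex[OF assms[unfolded invertible_def]] by (simp_all add: matrix_inv_def)

text \<open>Writes the entries of the inverse through determinants, so that
  \<open>G_mholomorphic\<close> can obtain their holomorphy from
  \<open>mholomorphic_on_det\<close>.\<close>

lemma matrix_inv_nth_cramer:
  fixes A :: "complex ^ 'n ^ 'n"
  assumes "det A \<noteq> 0"
  shows "matrix_inv A $ k $ l =
    det (\<chi> i j. if j = k then axis l 1 $ i else A $ i $ j) * inverse (det A)"
proof -
  have "A ** matrix_inv A = mat 1"
    using assms by (simp add: invertible_det_nz matrix_inv_inverse(1))
  then have "(A ** matrix_inv A) *v axis l 1 = axis l 1"
    by simp
  then have "A *v (matrix_inv A *v axis l 1) = axis l 1"
    by (simp add: matrix_vector_mul_assoc)
  then have "matrix_inv A *v axis l 1 =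
      (\<chi> k. det (\<chi> i j. if j = k then axis l 1 $ i else A $ i $ j) / det A)"
    unfolding cramer[OF assms] .
  then have "(matrix_inv A *v axis l 1) $ k =
      det (\<chi> i j. if j = k then axis l 1 $ i else A $ i $ j) / det A"
    by simp
  moreover have "(matrix_inv A *v axis l 1) $ k = matrix_inv A $ k $ l"
    by (simp add: matrix_vector_mult_def axis_def if_distrib cong: if_cong)
  ultimately show ?thesis
    by (simp only: divide_inverse)
qed

lemma sum_delta_mult:
  fixes h :: "'n::finite \<Rightarrow> 'a::semiring_1"
  shows "(\<Sum>m\<in>UNIV. (if m = i then 1 else 0) * h m) = h i"
    and "(\<Sum>m\<in>UNIV. (if i = m then 1 else 0) * h m) = h i"
  by (simp_all add: if_distrib[of "\<lambda>x. x * _"] cong: if_cong)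

text \<open>\<open>\<Gamma>\<close> is a connection with trace-free projective part \<open>S\<close>; \<open>dS m\<close> and \<open>dp i j\<close> play the roles of
  \<open>\<partial>\<^sub>m S\<^sup>m\<^sub>i\<^sub>j\<close> (for the fixed \<open>i\<close>, \<open>j\<close>) and \<open>\<partial>\<^sub>i p\<^sub>j\<close>, and \<open>flat\<close> is the contracted flatness equation.\<close>

lemma contracted_curvature:
  fixes S \<Gamma> :: "'n::finite \<Rightarrow> 'n \<Rightarrow> 'n \<Rightarrow> complex" and p dS :: "'n \<Rightarrow> complex"
    and dp :: "'n \<Rightarrow> 'n \<Rightarrow> complex"
  defines "n \<equiv> of_nat CARD('n)"
  assumes \<Gamma>: "\<And>k i j. \<Gamma> k i j = S k i j - ((if k = i then 1 else 0) * p j + (if k = j then 1 else 0) * p i)"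
    and sym: "\<And>k i j. S k i j = S k j i"
    and tr: "\<And>j. (\<Sum>k\<in>UNIV. S k k j) = 0"
    and dp: "\<And>i j. dp i j = dp j i"
    and flat: "(\<Sum>m\<in>UNIV. dS m - ((if m = i then 1 else 0) * dp m j + (if m = j then 1 else 0) * dp m i))
        + (\<Sum>m\<in>UNIV. \<Sum>k\<in>UNIV. \<Gamma> m m k * \<Gamma> k i j)
      = - (n + 1) * dp i j + (\<Sum>m\<in>UNIV. \<Sum>k\<in>UNIV. \<Gamma> m i k * \<Gamma> k m j)"
  shows "(n - 1) * (dp i j + p i * p j - (\<Sum>k\<in>UNIV. p k * S k i j))
       = (\<Sum>m\<in>UNIV. \<Sum>k\<in>UNIV. S m i k * S k m j) - (\<Sum>m\<in>UNIV. dS m)"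
proof -
  define d where "d a b = (if a = b then 1 else (0 :: complex))" for a b :: 'n
  have dL: "(\<Sum>m\<in>UNIV. d m a * h m) = h a" and dR: "(\<Sum>m\<in>UNIV. d a m * h m) = h a" for a h
    unfolding d_def by (rule sum_delta_mult)+
  note \<Gamma>d = \<Gamma>[folded d_def]
  define pS where "pS i j = (\<Sum>k\<in>UNIV. p k * S k i j)" for i j
  \<comment> \<open>The trace of \<open>S\<close> vanishes; the first Kronecker delta contributes
    \<open>n\<close> copies of \<open>p k\<close> and the second one more.\<close>
  have tr\<Gamma>: "(\<Sum>m\<in>UNIV. \<Gamma> m m k) = - (n + 1) * p k" for k
  proof -
    have "(\<Sum>m\<in>UNIV. \<Gamma> m m k) = (\<Sum>m\<in>UNIV. S m m k) - ((\<Sum>m\<in>(UNIV::'n set). p k) + (\<Sum>m\<in>UNIV. d m k * p m))"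
      unfolding sum_subtractf[symmetric] sum.distrib[symmetric] by (simp add: \<Gamma>d) (simp add: d_def)
    then show ?thesis unfolding tr dL by (simp add: n_def algebra_simps)
  qed
  have T1: "(\<Sum>m\<in>UNIV. \<Sum>k\<in>UNIV. \<Gamma> m m k * \<Gamma> k i j) = - (n + 1) * (pS i j - 2 * p i * p j)"
  proof -
    have "(\<Sum>m\<in>UNIV. \<Sum>k\<in>UNIV. \<Gamma> m m k * \<Gamma> k i j) = (\<Sum>k\<in>UNIV. - (n + 1) * p k * \<Gamma> k i j)"
      by (subst sum.swap) (simp only: sum_distrib_right[symmetric] tr\<Gamma>)
    also have "\<dots> = - (n + 1) * (\<Sum>k\<in>UNIV. p k * S k i j - (d k i * (p k * p j) + d k j * (p k * p i)))"
      unfolding sum_distrib_left by (intro sum.cong) (simp_all add: \<Gamma>d algebra_simps)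
    also have "(\<Sum>k\<in>UNIV. p k * S k i j - (d k i * (p k * p j) + d k j * (p k * p i))) = pS i j - 2 * p i * p j"
      by (simp add: sum_subtractf sum.distrib dL pS_def)
    finally show ?thesis .
  qed
  have inner: "(\<Sum>k\<in>UNIV. \<Gamma> m i k * \<Gamma> k m j) = (\<Sum>k\<in>UNIV. S m i k * S k m j)
      - (S m m i * p j + p m * S m i j) - (d m i * pS m j + p i * S m m j)
      + (d m i * (p m * p j) + d m i * (p j * p m) + p i * p j + d m j * (p i * p m))" for m
  proof -
    have "(\<Sum>k\<in>UNIV. \<Gamma> m i k * \<Gamma> k m j) = (\<Sum>k\<in>UNIV. S m i k * S k m j
      - (d k m * (S m i k * p j) + d k j * (S m i k * p m)) - (d m i * (p k * S k m j) + d m k * (p i * S k m j))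
      + (d k m * (d m i * (p k * p j)) + d k j * (d m i * (p k * p m)) + d m k * (d k m * (p i * p j)) + d m k * (d k j * (p i * p m))))"
      by (intro sum.cong) (simp_all add: \<Gamma>d algebra_simps)
    also have "\<dots> = (\<Sum>k\<in>UNIV. S m i k * S k m j)
      - (S m i m * p j + S m i j * p m) - (d m i * pS m j + p i * S m m j)
      + (d m i * (p m * p j) + d m i * (p j * p m) + d m m * (p i * p j) + d m j * (p i * p m))"
      unfolding sum_subtractf sum.distrib sum_distrib_left[symmetric] dL dR pS_def ..
    finally show ?thesis
      using sym[of m i m] by (simp add: d_def[of m m] mult.commute)
  qed
  have T2: "(\<Sum>m\<in>UNIV. \<Sum>k\<in>UNIV. \<Gamma> m i k * \<Gamma> k m j) =
      (\<Sum>m\<in>UNIV. \<Sum>k\<in>UNIV. S m i k * S k m j) - 2 * pS i j + (n + 3) * p i * p j"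
  proof -
    have "(\<Sum>m\<in>UNIV. \<Sum>k\<in>UNIV. \<Gamma> m i k * \<Gamma> k m j) =
      (\<Sum>m\<in>UNIV. \<Sum>k\<in>UNIV. S m i k * S k m j)
      - ((\<Sum>m\<in>UNIV. S m m i) * p j + pS i j) - (pS i j + p i * (\<Sum>m\<in>UNIV. S m m j))
      + (p i * p j + p j * p i + (\<Sum>m\<in>(UNIV::'n set). p i * p j) + p i * p j)"
      unfolding inner sum_subtractf sum.distrib sum_distrib_left[symmetric] sum_distrib_right[symmetric] dL
      by (simp add: pS_def)
    then show ?thesis by (simp add: tr n_def algebra_simps)
  qed
  have T0: "(\<Sum>m\<in>UNIV. dS m - ((if m = i then 1 else 0) * dp m j + (if m = j then 1 else 0) * dp m i)) = (\<Sum>m\<in>UNIV. dS m) - 2 * dp i j"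
    unfolding sum_subtractf sum.distrib sum_delta_mult using dp[of j i] by simp
  \<comment> \<open>After all contractions, \<open>dp i j\<close>, \<open>p i * p j\<close> and the
    sum of \<open>p k * S k i j\<close> carry the common factor \<open>n - 1\<close> up to
    sign.\<close>
  have solve: "(c - 1) * (q + a * b - s) = T - D"
    if "D - 2 * q + - (c + 1) * (s - 2 * a * b) = - (c + 1) * q + (T - 2 * s + (c + 3) * a * b)"
    for D T q s a b c :: complex
    using that by algebra
  show ?thesis
    unfolding pS_def[symmetric] by (rule solve[OF flat[unfolded T0 T1 T2]])
qed

text \<open>The complex matrix supplied by holomorphy has the partial derivatives as entries. The
  chain rule applied to the local inverse composed with \<open>f\<close> gives this matrix a left
  inverse.\<close>

lemma locally_biholomorphic_on_derivative:
  fixes f :: "complex ^ 'n \<Rightarrow> complex ^ 'n"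
  assumes f: "locally_biholomorphic_on f S" and z: "z \<in> S"
  shows "(f has_derivative (\<lambda>v. jacobian_mat f z *v v)) (at z)" and "det (jacobian_mat f z) \<noteq> 0"
proof -
  obtain U V g where Uall: "z \<in> U \<and> U \<subseteq> S \<and> open U \<and> open V \<and> homeomorphism U V f g \<and>
      holomorphic_map_on f U \<and> holomorphic_map_on g V"
    using bspec[OF f[unfolded locally_biholomorphic_on_def] z] by (elim exE)
  then have U: "z \<in> U" "open U" "homeomorphism U V f g"
    by simp_all
  have hol: "\<forall>z\<in>U. \<exists>A. (f has_derivative (\<lambda>v. A *v v)) (at z)"
      "\<forall>z\<in>V. \<exists>A. (g has_derivative (\<lambda>v. A *v v)) (at z)"
    using Uall unfolding holomorphic_map_on_def by simp_all
  obtain A where A: "(f has_derivative (\<lambda>v. A *v v)) (at z)"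
    using bspec[OF hol(1) U(1)] by (elim exE)
  have "partial j (\<lambda>x. f x $ l) z = A $ l $ j" for l j
    by (rule partial_eqI, rule has_derivative_eq_rhs[OF bounded_linear.has_derivative[OF bounded_linear_vec_nth A]])
       (simp add: matrix_vector_mult_def)
  then have jac: "jacobian_mat f z = A"
    by (simp add: jacobian_mat_def vec_eq_iff)
  show "(f has_derivative (\<lambda>v. jacobian_mat f z *v v)) (at z)"
    by (simp add: jac A)
  have "f z \<in> V" using U by (auto simp: homeomorphism_def)
  from bspec[OF hol(2) this] obtain B where B: "(g has_derivative (\<lambda>v. B *v v)) (at (f z))"
    by (elim exE)
  have "((\<lambda>x. g (f x)) has_derivative (\<lambda>v. B *v (A *v v))) (at z)"
    by (rule has_derivative_compose[OF A B])
  moreover have "((\<lambda>x. g (f x)) has_derivative (\<lambda>v. v)) (at z)"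
    by (rule has_derivative_transform_within_open[OF has_derivative_ident U(2,1)])
       (use U(3) in \<open>auto simp: homeomorphism_def\<close>)
  ultimately have "(\<lambda>v. B *v (A *v v)) = (\<lambda>v. v)"
    by (rule has_derivative_unique)
  then have "B ** A = mat 1"
    by (simp add: matrix_eq matrix_vector_mul_assoc fun_eq_iff)
  then show "det (jacobian_mat f z) \<noteq> 0"
    unfolding jac using invertible_det_nz invertible_left_inverse by blast
qed

section \<open>Connection coefficients of a fixed map and their flatness\<close>

locale locally_biholomorphic_map =
  fixes f :: "complex ^ 'n \<Rightarrow> complex ^ 'n" and S :: "(complex ^ 'n) set"
  assumes open_S: "open S" and locally_biholomorphic: "locally_biholomorphic_on f S"
begin

definition F :: "'n \<Rightarrow> 'n \<Rightarrow> complex ^ 'n \<Rightarrow> complex" where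
  "F l j = partial j (\<lambda>x. f x $ l)"

definition G :: "'n \<Rightarrow> 'n \<Rightarrow> complex ^ 'n \<Rightarrow> complex" where
  "G k l z = matrix_inv (jacobian_mat f z) $ k $ l"

text \<open>Christoffel symbols of the pullback under \<open>f\<close> of the standard flat
  connection on the target space; \<open>F_\<Gamma>\<close> is their defining relation.\<close>

definition \<Gamma> :: "'n \<Rightarrow> 'n \<Rightarrow> 'n \<Rightarrow> complex ^ 'n \<Rightarrow> complex" where
  "\<Gamma> k i j z = (\<Sum>l\<in>UNIV. partial i (F l j) z * G k l z)"

text \<open>\<open>p j\<close> is the logarithmic derivative of \<open>u\<close> in direction \<open>j\<close>.\<close>

definition p :: "'n \<Rightarrow> complex ^ 'n \<Rightarrow> complex" where
  "p j z = - (1 / (of_nat CARD('n) + 1)) * partial_log j (jacobian_det f) z"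

text \<open>Indexed so that each Schwarzian coefficient is a scalar function to which the rules for
  \<open>partial\<close> apply. By \<open>\<S>_eq\<close> and \<open>\<S>_trace\<close> these
  functions form the trace-free part of \<open>\<Gamma>\<close>.\<close>

definition \<S> :: "'n \<Rightarrow> 'n \<Rightarrow> 'n \<Rightarrow> complex ^ 'n \<Rightarrow> complex" where
  "\<S> k i j z = schwarzian f k z $ i $ j"

lemma component_mholomorphic: "(\<lambda>x. f x $ l) mholomorphic_on S"
proof (rule mholomorphic_onI[where c = "\<lambda>z j. jacobian_mat f z $ l $ j"])
  fix z assume "z \<in> S"
  from bounded_linear.has_derivative[OF bounded_linear_vec_nth
      locally_biholomorphic_on_derivative(1)[OF locally_biholomorphic this]]
  show "((\<lambda>x. f x $ l) has_derivative (\<lambda>v. \<Sum>j\<in>UNIV. jacobian_mat f z $ l $ j * v $ j)) (at z)"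
    by (rule has_derivative_eq_rhs) (simp add: matrix_vector_mult_def)
qed

lemma jacobian_mat_nth: "jacobian_mat f z $ l $ j = F l j z"
  by (simp add: jacobian_mat_def F_def)

lemma jacobian_det_nonzero: "z \<in> S \<Longrightarrow> jacobian_det f z \<noteq> 0"
  unfolding jacobian_det_def by (rule locally_biholomorphic_on_derivative(2)[OF locally_biholomorphic])

lemma F_mholomorphic: "F l j mholomorphic_on S"
  unfolding F_def by (rule partial_mholomorphic(1)[OF component_mholomorphic open_S])

lemma partial_F_sym: "z \<in> S \<Longrightarrow> partial i (F l j) z = partial j (F l i) z"
  unfolding F_def by (rule partial_mholomorphic(2)[OF component_mholomorphic open_S])

lemma jacobian_det_mholomorphic: "jacobian_det f mholomorphic_on S"
  unfolding jacobian_det_def[abs_def]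
  by (rule mholomorphic_on_det) (simp add: jacobian_mat_nth F_mholomorphic)

lemma G_mholomorphic: "G k l mholomorphic_on S"
proof (rule mholomorphic_on_cong[OF open_S])
  show "(\<lambda>z. det (\<chi> i j. if j = k then axis l 1 $ i else jacobian_mat f z $ i $ j) *
      inverse (jacobian_det f z)) mholomorphic_on S"
  proof (intro mholomorphic_on_mult(1) mholomorphic_on_det
      mholomorphic_on_inverse(1)[OF jacobian_det_mholomorphic jacobian_det_nonzero])
    fix a b
    show "(\<lambda>z. (\<chi> i j. if j = k then axis l 1 $ i else jacobian_mat f z $ i $ j) $ a $ b) mholomorphic_on S"
      by (cases "b = k") (simp_all add: mholomorphic_on_const jacobian_mat_nth F_mholomorphic)
  qed
next
  fix z assume "z \<in> S"
  then show "det (\<chi> i j. if j = k then axis l 1 $ i else jacobian_mat f z $ i $ j) *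
      inverse (jacobian_det f z) = G k l z"
    using matrix_inv_nth_cramer[of "jacobian_mat f z" k l] jacobian_det_nonzero
    by (simp add: G_def jacobian_det_def)
qed

lemma F_G: "z \<in> S \<Longrightarrow> (\<Sum>k\<in>UNIV. F l k z * G k m z) = (if l = m then 1 else 0)"
  and G_F: "z \<in> S \<Longrightarrow> (\<Sum>k\<in>UNIV. G l k z * F k m z) = (if l = m then 1 else 0)"
proof -
  assume "z \<in> S"
  then have inv: "invertible (jacobian_mat f z)"
    using jacobian_det_nonzero by (simp add: invertible_det_nz jacobian_det_def)
  show "(\<Sum>k\<in>UNIV. F l k z * G k m z) = (if l = m then 1 else 0)"
    using matrix_inv_inverse(1)[OF inv]
    by (simp add: vec_eq_iff matrix_matrix_mult_def mat_def G_def jacobian_mat_nth)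
  show "(\<Sum>k\<in>UNIV. G l k z * F k m z) = (if l = m then 1 else 0)"
    using matrix_inv_inverse(2)[OF inv]
    by (simp add: vec_eq_iff matrix_matrix_mult_def mat_def G_def jacobian_mat_nth)
qed

text \<open>Jacobi's formula. Multiplying by the inverse \<open>B\<close> of the Jacobian matrix
  frozen at \<open>z\<close> changes the determinant by a constant factor and makes the matrix the
  identity at \<open>z\<close>, where the derivative of the determinant is a trace.\<close>

lemma partial_jacobian_det:
  assumes z: "z \<in> S"
  shows "partial i (jacobian_det f) z = jacobian_det f z * (\<Sum>a\<in>UNIV. \<Gamma> a i a z)"
proof -
  define B where "B = matrix_inv (jacobian_mat f z)"
  have inv: "invertible (jacobian_mat f z)"
    using jacobian_det_nonzero[OF z] by (simp add: invertible_det_nz jacobian_det_def)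
  have BJ: "B ** jacobian_mat f z = mat 1"
    unfolding B_def by (rule matrix_inv_inverse(2)[OF inv])
  have entry: "(B ** jacobian_mat f x) $ a $ b = (\<Sum>l\<in>UNIV. G a l z * F l b x)" for x a b
    by (simp add: matrix_matrix_mult_def B_def G_def jacobian_mat_nth)
  have hol: "(\<lambda>x. (B ** jacobian_mat f x) $ a $ b) mholomorphic_on S" for a b
    unfolding entry by (intro mholomorphic_on_sum(1) mholomorphic_on_mult(1) mholomorphic_on_const F_mholomorphic)
  have "det B * jacobian_det f z = 1"
    using BJ det_mul[of B "jacobian_mat f z"] by (simp add: jacobian_det_def)
  then have J: "jacobian_det f x = jacobian_det f z * det (B ** jacobian_mat f x)" for x
    by (simp add: det_mul jacobian_det_def[of f x] mult.assoc[symmetric] mult.commute[of _ "det B"])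
  have "partial i (jacobian_det f) z = partial i (\<lambda>x. jacobian_det f z * det (B ** jacobian_mat f x)) z"
    by (subst J[abs_def]) (rule refl)
  also have "\<dots> = jacobian_det f z * partial i (\<lambda>x. det (B ** jacobian_mat f x)) z"
    by (rule partial_cmult[OF mholomorphic_on_det[OF hol] z])
  also have "partial i (\<lambda>x. det (B ** jacobian_mat f x)) z
      = (\<Sum>a\<in>UNIV. partial i (\<lambda>x. \<Sum>l\<in>UNIV. G a l z * F l a x) z)"
    using partial_det_at_mat_1[OF hol z BJ] by (simp add: entry)
  also have "\<dots> = (\<Sum>a\<in>UNIV. \<Gamma> a i a z)"
  proof (rule sum.cong[OF refl])
    fix a
    have "partial i (\<lambda>x. \<Sum>l\<in>UNIV. G a l z * F l a x) z = (\<Sum>l\<in>UNIV. partial i (\<lambda>x. G a l z * F l a x) z)"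
      by (rule mholomorphic_on_sum(2)[OF _ z]) (intro mholomorphic_on_mult(1) mholomorphic_on_const F_mholomorphic)
    also have "\<dots> = (\<Sum>l\<in>UNIV. G a l z * partial i (F l a) z)"
      by (simp add: partial_cmult[OF F_mholomorphic z])
    finally show "partial i (\<lambda>x. \<Sum>l\<in>UNIV. G a l z * F l a x) z = \<Gamma> a i a z"
      by (simp add: \<Gamma>_def mult.commute)
  qed
  finally show ?thesis .
qed

lemma \<Gamma>_sym: "z \<in> S \<Longrightarrow> \<Gamma> k i j z = \<Gamma> k j i z"
  by (simp add: \<Gamma>_def partial_F_sym[of z i _ j])

text \<open>By Jacobi's formula this contraction is the logarithmic derivative of the Jacobian
  determinant. It is also why the normalisation in \<open>p\<close> makes \<open>\<S>\<close>
  trace-free.\<close>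

lemma \<Gamma>_trace: "z \<in> S \<Longrightarrow> (\<Sum>k\<in>UNIV. \<Gamma> k k j z) = - (of_nat CARD('n) + 1) * p j z"
proof -
  assume z: "z \<in> S"
  have "of_nat CARD('n) + 1 \<noteq> (0 :: complex)"
    using of_nat_neq_0[of "CARD('n)"] by (simp add: add.commute)
  moreover have "- c * (- (1 / c) * x) = x" if "c \<noteq> 0" for c x :: complex
    using that by simp
  ultimately have "- (of_nat CARD('n) + 1) * p j z = partial_log j (jacobian_det f) z"
    unfolding p_def by blast
  also have "\<dots> = (\<Sum>k\<in>UNIV. \<Gamma> k j k z)"
    by (simp add: partial_log_def partial_jacobian_det[OF z] jacobian_det_nonzero[OF z])
  finally show ?thesis by (simp add: \<Gamma>_sym[OF z, of _ j])
qed

lemma \<S>_eq: "\<S> k i j z = \<Gamma> k i j z + ((if k = i then 1 else 0) * p j z + (if k = j then 1 else 0) * p i z)"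
  by (simp add: \<S>_def schwarzian_def \<Gamma>_def F_def[abs_def] G_def p_def algebra_simps)

lemma F_\<Gamma>: "z \<in> S \<Longrightarrow> (\<Sum>k\<in>UNIV. F l k z * \<Gamma> k i j z) = partial i (F l j) z"
proof -
  assume z: "z \<in> S"
  have "(\<Sum>k\<in>UNIV. F l k z * \<Gamma> k i j z) = (\<Sum>m\<in>UNIV. (\<Sum>k\<in>UNIV. F l k z * G k m z) * partial i (F m j) z)"
    unfolding \<Gamma>_def sum_distrib_left sum_distrib_right by (subst sum.swap) (simp add: mult_ac)
  then show ?thesis by (simp add: F_G[OF z] sum_delta_mult)
qed

lemma \<Gamma>_mholomorphic: "\<Gamma> k i j mholomorphic_on S"
  unfolding \<Gamma>_def[abs_def]
  by (intro mholomorphic_on_sum(1) mholomorphic_on_mult(1) G_mholomorphic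
      partial_mholomorphic(1)[OF F_mholomorphic open_S])

text \<open>Differentiating \<open>F_\<Gamma>\<close> expresses the third derivatives of
  \<open>f\<close> as the Jacobian matrix applied to \<open>X m i\<close>. Their symmetry in
  \<open>m\<close> and \<open>i\<close> passes to \<open>X\<close> after multiplication by the
  inverse matrix.\<close>

lemma partial_\<Gamma>_flat:
  assumes z: "z \<in> S"
  shows "partial m (\<Gamma> q i j) z + (\<Sum>k\<in>UNIV. \<Gamma> q m k z * \<Gamma> k i j z) =
         partial i (\<Gamma> q m j) z + (\<Sum>k\<in>UNIV. \<Gamma> q i k z * \<Gamma> k m j z)"
proof -
  define X where "X m i q = partial m (\<Gamma> q i j) z + (\<Sum>k\<in>UNIV. \<Gamma> q m k z * \<Gamma> k i j z)" for m i q
  have FX: "(\<Sum>q\<in>UNIV. F l q z * X m i q) = partial m (partial i (F l j)) z" for l m i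
  proof -
    have "partial m (partial i (F l j)) z = partial m (\<lambda>z. \<Sum>k\<in>UNIV. F l k z * \<Gamma> k i j z) z"
      by (rule partial_cong[OF open_S partial_mholomorphic(1)[OF F_mholomorphic open_S] _ z])
         (simp add: F_\<Gamma>)
    also have "\<dots> = (\<Sum>k\<in>UNIV. partial m (F l k) z * \<Gamma> k i j z + F l k z * partial m (\<Gamma> k i j) z)"
      by (subst mholomorphic_on_sum(2)[OF _ z])
         (simp_all add: mholomorphic_on_mult[OF F_mholomorphic \<Gamma>_mholomorphic] z)
    also have "\<dots> = (\<Sum>k\<in>UNIV. \<Sum>q\<in>UNIV. F l q z * (\<Gamma> q m k z * \<Gamma> k i j z)) + (\<Sum>q\<in>UNIV. F l q z * partial m (\<Gamma> q i j) z)"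
      by (simp add: sum.distrib F_\<Gamma>[OF z, symmetric] sum_distrib_right mult.assoc)
    also have "\<dots> = (\<Sum>q\<in>UNIV. F l q z * X m i q)"
      by (subst sum.swap) (simp add: X_def algebra_simps sum.distrib sum_distrib_left)
    finally show ?thesis ..
  qed
  have "(\<Sum>q\<in>UNIV. F l q z * X m i q) = (\<Sum>q\<in>UNIV. F l q z * X i m q)" for l
    unfolding FX by (rule partial_mholomorphic(2)[OF F_mholomorphic open_S z])
  then have "(\<Sum>l\<in>UNIV. G r l z * (\<Sum>q\<in>UNIV. F l q z * X m i q)) =
      (\<Sum>l\<in>UNIV. G r l z * (\<Sum>q\<in>UNIV. F l q z * X i m q))" for r
    by simp
  moreover have "(\<Sum>l\<in>UNIV. G r l z * (\<Sum>q\<in>UNIV. F l q z * Y q)) = Y r" for r Y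
  proof -
    have "(\<Sum>l\<in>UNIV. G r l z * (\<Sum>q\<in>UNIV. F l q z * Y q)) = (\<Sum>q\<in>UNIV. (\<Sum>l\<in>UNIV. G r l z * F l q z) * Y q)"
      unfolding sum_distrib_left sum_distrib_right by (subst sum.swap) (simp add: mult_ac)
    then show ?thesis by (simp add: G_F[OF z] sum_delta_mult)
  qed
  ultimately have "X m i q = X i m q" by simp
  then show ?thesis by (simp add: X_def)
qed

lemma p_mholomorphic: "p j mholomorphic_on S"
  unfolding p_def[abs_def] partial_log_def divide_inverse
  by (intro mholomorphic_on_mult(1) mholomorphic_on_const partial_mholomorphic(1)
      mholomorphic_on_inverse(1) jacobian_det_mholomorphic jacobian_det_nonzero open_S)

text \<open>As a logarithmic gradient \<open>p\<close> is closed: symmetry reduces to that of the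
  second derivatives of the Jacobian determinant.\<close>

lemma partial_p_sym:
  assumes z: "z \<in> S"
  shows "partial i (p j) z = partial j (p i) z"
proof -
  let ?J = "jacobian_det f"
  note J = jacobian_det_mholomorphic
  note dJ = partial_mholomorphic(1)[OF J open_S]
  note iJ = mholomorphic_on_inverse[OF J jacobian_det_nonzero]
  have "partial i (p j) z = - (1 / (of_nat CARD('n) + 1)) *
     (partial i (partial j ?J) z * inverse (?J z) + partial j ?J z * (- partial i ?J z / (?J z)\<^sup>2))" for i j
    unfolding p_def[abs_def] partial_log_def divide_inverse[of "partial _ _ _"]
    by (subst partial_cmult[OF mholomorphic_on_mult(1)[OF dJ iJ(1)] z])
       (simp_all add: mholomorphic_on_mult(2)[OF dJ iJ(1) z] iJ(2) z)
  then show ?thesis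
    using partial_mholomorphic(2)[OF J open_S z, of i j] by (simp add: mult.commute)
qed

lemma \<S>_mholomorphic: "\<S> k i j mholomorphic_on S"
  unfolding \<S>_eq[abs_def]
  by (intro mholomorphic_on_add(1) mholomorphic_on_mult(1) mholomorphic_on_const \<Gamma>_mholomorphic p_mholomorphic)

lemma \<S>_sym: "z \<in> S \<Longrightarrow> \<S> k i j z = \<S> k j i z"
  by (simp add: \<S>_eq \<Gamma>_sym[of z k i j] add.commute)

lemma \<S>_trace: "z \<in> S \<Longrightarrow> (\<Sum>k\<in>UNIV. \<S> k k j z) = 0"
  unfolding \<S>_eq sum.distrib sum_delta_mult \<Gamma>_trace by (simp add: algebra_simps)

lemma partial_\<S>:
  assumes z: "z \<in> S"
  shows "partial m (\<S> k i j) z = partial m (\<Gamma> k i j) z +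
     ((if k = i then 1 else 0) * partial m (p j) z + (if k = j then 1 else 0) * partial m (p i) z)"
proof -
  note c = mholomorphic_on_mult(1)[OF mholomorphic_on_const p_mholomorphic]
  show ?thesis
    unfolding \<S>_eq[abs_def]
    by (simp add: mholomorphic_on_add(2)[OF \<Gamma>_mholomorphic mholomorphic_on_add(1)[OF c c] z]
        mholomorphic_on_add(2)[OF c c z] partial_cmult[OF p_mholomorphic z] del: mult_cancel_right1 if_distrib)
qed

text \<open>The right-hand side of \<open>contracted_curvature\<close> divided by
  \<open>n - 1\<close>. In one variable this would be a division by zero with default value 0, so
  \<open>partial_p\<close> assumes at least two variables.\<close>

definition R :: "'n \<Rightarrow> 'n \<Rightarrow> complex ^ 'n \<Rightarrow> complex" where
  "R i j z = ((\<Sum>m\<in>UNIV. \<Sum>k\<in>UNIV. \<S> m i k z * \<S> k m j z) - (\<Sum>m\<in>UNIV. partial m (\<S> m i j) z))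
      / (of_nat CARD('n) - 1)"

text \<open>The linear system for \<open>u\<close>, divided by \<open>u\<close>: the quadratic term
  comes from passing to logarithmic derivatives. It is the contracted flatness equation solved for
  the derivatives of \<open>p\<close>.\<close>

lemma partial_p:
  assumes n: "CARD('n) \<ge> 2" and z: "z \<in> S"
  shows "partial i (p j) z = R i j z + (\<Sum>k\<in>UNIV. p k z * \<S> k i j z) - p i z * p j z"
proof -
  have "(of_nat CARD('n) - 1) * (partial i (p j) z + p i z * p j z - (\<Sum>k\<in>UNIV. p k z * \<S> k i j z))
      = (\<Sum>m\<in>UNIV. \<Sum>k\<in>UNIV. \<S> m i k z * \<S> k m j z) - (\<Sum>m\<in>UNIV. partial m (\<S> m i j) z)"
  proof (rule contracted_curvature[where \<Gamma> = "\<lambda>k i j. \<Gamma> k i j z" and dp = "\<lambda>i j. partial i (p j) z"])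
    show "\<Gamma> k i j z = \<S> k i j z - ((if k = i then 1 else 0) * p j z + (if k = j then 1 else 0) * p i z)" for k i j
      by (simp add: \<S>_eq)
    \<comment> \<open>Contract flatness by setting \<open>q = m\<close> and summing, so that
      \<open>\<Gamma>_trace\<close> applies to the derivative in direction \<open>i\<close>.\<close>
    have "(\<Sum>m\<in>UNIV. partial m (\<Gamma> m i j) z + (\<Sum>k\<in>UNIV. \<Gamma> m m k z * \<Gamma> k i j z))
        = (\<Sum>m\<in>UNIV. partial i (\<Gamma> m m j) z + (\<Sum>k\<in>UNIV. \<Gamma> m i k z * \<Gamma> k m j z))"
      by (rule sum.cong[OF refl partial_\<Gamma>_flat[OF z]])
    moreover have "(\<Sum>m\<in>UNIV. partial i (\<Gamma> m m j) z) = - (of_nat CARD('n) + 1) * partial i (p j) z"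
    proof -
      have "(\<Sum>m\<in>UNIV. partial i (\<Gamma> m m j) z) = partial i (\<lambda>z. \<Sum>m\<in>UNIV. \<Gamma> m m j z) z"
        by (rule mholomorphic_on_sum(2)[symmetric, OF \<Gamma>_mholomorphic z])
      also have "\<dots> = partial i (\<lambda>z. - (of_nat CARD('n) + 1) * p j z) z"
        by (rule partial_cong[OF open_S mholomorphic_on_sum(1)[OF \<Gamma>_mholomorphic] \<Gamma>_trace z])
      finally show ?thesis by (simp only: partial_cmult[OF p_mholomorphic z])
    qed
    ultimately show "(\<Sum>m\<in>UNIV. partial m (\<S> m i j) z - ((if m = i then 1 else 0) * partial m (p j) z + (if m = j then 1 else 0) * partial m (p i) z))
        + (\<Sum>m\<in>UNIV. \<Sum>k\<in>UNIV. \<Gamma> m m k z * \<Gamma> k i j z)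
      = - (of_nat CARD('n) + 1) * partial i (p j) z + (\<Sum>m\<in>UNIV. \<Sum>k\<in>UNIV. \<Gamma> m i k z * \<Gamma> k m j z)"
      by (simp only: partial_\<S>[OF z] add_diff_cancel_right' sum.distrib)
  qed (rule \<S>_sym[OF z] \<S>_trace[OF z] partial_p_sym[OF z])+
  moreover have "of_nat CARD('n) - 1 \<noteq> (0 :: complex)"
    using n of_nat_eq_1_iff[of "CARD('n)", where 'a = complex] by auto
  ultimately show ?thesis
    by (simp add: R_def field_simps)
qed

end

section \<open>Estimates in the Bergman norm\<close>

lemma open_polydisc: "open (polydisc :: (complex ^ 'n) set)"
proof -
  have eq: "polydisc = (\<Inter>i. {z :: complex ^ 'n. cmod (z $ i) < 1})"
    by (auto simp: polydisc_def)
  show ?thesis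
    unfolding eq by (intro open_INT ballI open_Collect_less continuous_intros) simp
qed

lemma polydiscI: "(\<And>i. cmod (z $ i) \<le> r) \<Longrightarrow> r < 1 \<Longrightarrow> z \<in> polydisc"
  by (auto simp: polydisc_def intro: le_less_trans)

text \<open>The weights \<open>1 / (1 - (cmod (z $ i))\<^sup>2)\<^sup>2\<close> are at least 1
  throughout the polydisc.\<close>

lemma norm_nth_le_bergman_norm:
  fixes w :: "complex ^ 'n"
  assumes z: "z \<in> polydisc"
  shows "cmod (w $ k) \<le> bergman_norm z w"
proof -
  define h where "h i = (cmod (w $ i))\<^sup>2 / (1 - (cmod (z $ i))\<^sup>2)\<^sup>2" for i
  have d: "0 < 1 - (cmod (z $ i))\<^sup>2" "1 - (cmod (z $ i))\<^sup>2 \<le> 1" for i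
    using z by (simp_all add: polydisc_def abs_square_less_1)
  have "(cmod (w $ k))\<^sup>2 * 1 \<le> (cmod (w $ k))\<^sup>2 * (1 / (1 - (cmod (z $ k))\<^sup>2)\<^sup>2)"
    using d[of k] by (intro mult_left_mono) (auto simp: power_le_one)
  then have "(cmod (w $ k))\<^sup>2 \<le> h k" by (simp add: h_def)
  also have "h k \<le> sum h UNIV"
    by (rule member_le_sum) (auto simp: h_def)
  also have "\<dots> \<le> 2 * sum h UNIV"
    using sum_nonneg[of UNIV h] by (simp add: h_def)
  finally show ?thesis
    unfolding bergman_norm_def h_def by (rule real_le_rsqrt)
qed

text \<open>For moduli up to 7/8 each weight is at most \<open>(64 / 15)\<^sup>2 < 20\<close>. The
  radius leaves room for Cauchy circles of radius 1/8 about points with moduli up to 3/4.\<close>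

lemma bergman_norm_power2_le:
  fixes v :: "complex ^ 'n"
  assumes z: "\<And>i. cmod (z $ i) \<le> 7 / 8"
  shows "(bergman_norm z v)\<^sup>2 \<le> 40 * (norm v)\<^sup>2"
proof -
  have "(cmod (v $ i))\<^sup>2 / (1 - (cmod (z $ i))\<^sup>2)\<^sup>2 \<le> 20 * (cmod (v $ i))\<^sup>2" for i
  proof -
    have "(cmod (z $ i))\<^sup>2 \<le> (7 / 8)\<^sup>2" by (intro power_mono z) auto
    then have "15 / 64 \<le> 1 - (cmod (z $ i))\<^sup>2" by (simp add: power2_eq_square)
    then have "(15 / 64)\<^sup>2 \<le> (1 - (cmod (z $ i))\<^sup>2)\<^sup>2" by (intro power_mono) auto
    then have "1 / 20 \<le> (1 - (cmod (z $ i))\<^sup>2)\<^sup>2" by (simp add: power2_eq_square)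
    then have "(cmod (v $ i))\<^sup>2 / (1 - (cmod (z $ i))\<^sup>2)\<^sup>2 \<le> (cmod (v $ i))\<^sup>2 / (1 / 20)"
      by (intro divide_left_mono) auto
    then show ?thesis by simp
  qed
  then have "2 * (\<Sum>i\<in>UNIV. (cmod (v $ i))\<^sup>2 / (1 - (cmod (z $ i))\<^sup>2)\<^sup>2) \<le> 2 * (\<Sum>i\<in>UNIV. 20 * (cmod (v $ i))\<^sup>2)"
    by (intro mult_left_mono sum_mono) auto
  also have "\<dots> = 40 * (norm v)\<^sup>2"
    by (simp add: norm_vec_def L2_set_def sum_nonneg sum_distrib_left[symmetric])
  finally show ?thesis
    unfolding bergman_norm_def by (subst real_sqrt_pow2) (auto intro!: sum_nonneg mult_nonneg_nonneg)
qed

lemma bergman_norm_scaleR: "bergman_norm z (c *\<^sub>R v) = \<bar>c\<bar> * bergman_norm z v"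
proof -
  have "2 * (\<Sum>i\<in>UNIV. (cmod ((c *\<^sub>R v) $ i))\<^sup>2 / (1 - (cmod (z $ i))\<^sup>2)\<^sup>2)
      = c\<^sup>2 * (2 * (\<Sum>i\<in>UNIV. (cmod (v $ i))\<^sup>2 / (1 - (cmod (z $ i))\<^sup>2)\<^sup>2))"
    by (simp add: power_mult_distrib sum_distrib_left mult_ac)
  then show ?thesis
    by (simp add: bergman_norm_def real_sqrt_mult)
qed

lemma schwarzian_op_scaleR: "schwarzian_op f z (c *\<^sub>R v) = c\<^sup>2 *\<^sub>R schwarzian_op f z v"
  unfolding schwarzian_op_def vec_eq_iff
  by (simp add: scaleR_sum_right power2_eq_square)

text \<open>The operator is homogeneous of degree two, so the bound on unit vectors scales. A vector
  of norm 0 cannot be normalised and is treated separately.\<close>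

lemma schwarzian_op_bound:
  fixes f :: "complex ^ 'n \<Rightarrow> complex ^ 'n"
  assumes f: "schwarzian_norm f \<le> ereal \<alpha>" and z: "z \<in> polydisc"
  shows "bergman_norm z (schwarzian_op f z v) \<le> \<alpha> * (bergman_norm z v)\<^sup>2"
proof (cases "bergman_norm z v = 0")
  case True
  have "cmod (v $ i) \<le> 0" for i
    using norm_nth_le_bergman_norm[OF z, of v i] True by simp
  then have "v = 0" by (simp add: vec_eq_iff)
  then have "schwarzian_op f z v = 0"
    using schwarzian_op_scaleR[of f z 0 v] by simp
  then show ?thesis
    using True bergman_norm_scaleR[of z 0 v] by simp
next
  case False
  define b where "b = bergman_norm z v"
  have "0 \<le> b" unfolding b_def bergman_norm_def by (auto intro!: sum_nonneg mult_nonneg_nonneg)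
  with False have b: "0 < b" by (simp add: b_def)
  have "bergman_norm z ((1 / b) *\<^sub>R v) = 1"
    using b by (simp add: bergman_norm_scaleR b_def[symmetric])
  then have "ereal (bergman_norm z (schwarzian_op f z ((1 / b) *\<^sub>R v))) \<le> schwarzian_norm_at f z"
    unfolding schwarzian_norm_at_def by (intro SUP_upper) simp
  also have "\<dots> \<le> schwarzian_norm f"
    unfolding schwarzian_norm_def by (intro SUP_upper z)
  also note f
  finally have "(1 / b)\<^sup>2 * bergman_norm z (schwarzian_op f z v) \<le> \<alpha>"
    by (simp add: schwarzian_op_scaleR bergman_norm_scaleR)
  then show ?thesis
    using b by (simp add: b_def[symmetric] field_simps)
qed

text \<open>Recovers the coefficients of a symmetric form from its quadratic values, which are all
  that the operator norm controls.\<close>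

lemma polarization:
  fixes s :: "'n::finite \<Rightarrow> 'n \<Rightarrow> complex"
  assumes sym: "\<And>a b. s a b = s b a"
  defines "Q \<equiv> \<lambda>v :: complex ^ 'n. \<Sum>a\<in>UNIV. \<Sum>b\<in>UNIV. v $ a * s a b * v $ b"
  shows "4 * s i j = Q (axis i 1 + axis j 1) - Q (axis i 1 - axis j 1)"
proof -
  define B where "B x y = (\<Sum>a\<in>UNIV. \<Sum>b\<in>UNIV. x $ a * s a b * y $ b)" for x y :: "complex ^ 'n"
  have "Q (x + y) - Q (x - y) = 2 * B x y + 2 * B y x" for x y
    unfolding Q_def B_def sum_distrib_left sum_subtractf[symmetric] sum.distrib[symmetric]
    by (intro sum.cong refl) (simp add: algebra_simps)
  moreover have "B (axis i 1) (axis j 1) = s i j" for i j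
  proof -
    have "B (axis i 1) (axis j 1) = (\<Sum>a\<in>UNIV. (if a = i then 1 else 0) * (\<Sum>b\<in>UNIV. (if b = j then 1 else 0) * s a b))"
      unfolding B_def by (simp add: axis_def sum_distrib_left mult_ac)
    then show ?thesis by (simp only: sum_delta_mult)
  qed
  ultimately show ?thesis using sym[of j i] by simp
qed

text \<open>The vectors \<open>axis i 1 + axis j 1\<close> and \<open>axis i 1 - axis j 1\<close>
  have norm at most 2, hence squared Bergman norm at most 160. Polarization adds two such values and
  divides by 4.\<close>

lemma schwarzian_bound:
  fixes f :: "complex ^ 'n \<Rightarrow> complex ^ 'n"
  assumes f: "schwarzian_norm f \<le> ereal \<alpha>" and \<alpha>: "0 \<le> \<alpha>"
    and sym: "\<And>a b. schwarzian f k z $ a $ b = schwarzian f k z $ b $ a"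
    and z: "\<And>i. cmod (z $ i) \<le> 7 / 8"
  shows "cmod (schwarzian f k z $ i $ j) \<le> 80 * \<alpha>"
proof -
  have zP: "z \<in> polydisc"
    by (rule polydiscI[OF z]) simp
  have op: "cmod (schwarzian_op f z v $ k) \<le> 160 * \<alpha>" if v: "norm v \<le> 2" for v
  proof -
    have "(norm v)\<^sup>2 \<le> 2\<^sup>2" using v by (intro power_mono) auto
    then have "\<alpha> * (bergman_norm z v)\<^sup>2 \<le> \<alpha> * 160"
      using bergman_norm_power2_le[OF z, of v] by (intro mult_left_mono \<alpha>) auto
    then show ?thesis
      using norm_nth_le_bergman_norm[OF zP, of "schwarzian_op f z v" k] schwarzian_op_bound[OF f zP, of v]
      by linarith
  qed
  have ax: "norm (axis a (1::complex)) = 1" for a :: 'n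
    using norm_smult_axis[of 1 a] by (simp add: smult_axis)
  have "cmod (4 * schwarzian f k z $ i $ j) \<le>
      cmod (schwarzian_op f z (axis i 1 + axis j 1) $ k) + cmod (schwarzian_op f z (axis i 1 - axis j 1) $ k)"
    unfolding polarization[of "\<lambda>a b. schwarzian f k z $ a $ b", OF sym] schwarzian_op_def vec_lambda_beta
    by (rule norm_triangle_ineq4)
  also have "\<dots> \<le> 160 * \<alpha> + 160 * \<alpha>"
    using norm_triangle_ineq[of "axis i (1::complex)" "axis j 1"] norm_triangle_ineq4[of "axis i (1::complex)" "axis j 1"]
    by (intro add_mono op) (simp_all add: ax)
  finally show ?thesis by (simp add: norm_mult)
qed

lemma partial_bound:
  fixes g :: "complex ^ 'n \<Rightarrow> complex"
  assumes g: "g mholomorphic_on S" and r: "0 < r"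
    and S: "\<And>x. cmod x \<le> r \<Longrightarrow> z + x *s axis i 1 \<in> S"
    and B: "\<And>x. cmod x \<le> r \<Longrightarrow> cmod (g (z + x *s axis i 1)) \<le> B"
  shows "cmod (partial i g z) \<le> B / r"
proof -
  define h where "h = (\<lambda>x. g (z + x *s axis i 1))"
  have h: "h field_differentiable (at x)" if "cmod x \<le> r" for x
    unfolding h_def field_differentiable_def
    using mholomorphic_DERIV_line[OF g S[OF that]] by blast
  have "norm ((deriv ^^ 1) h 0) \<le> fact 1 * B / r ^ 1"
  proof (rule Cauchy_inequality)
    show "h holomorphic_on ball 0 r"
      by (auto simp: holomorphic_on_def intro!: field_differentiable_at_within h)
    show "continuous_on (cball 0 r) h"
      by (auto intro!: continuous_at_imp_continuous_on field_differentiable_imp_continuous_at h)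
    show "norm (h x) \<le> B" if "norm (0 - x) = r" for x
      using B[of x] that by (simp add: h_def)
  qed (rule r)
  then show ?thesis by (simp add: h_def partial_eq_deriv_line)
qed

section \<open>The gradient bound for a single map\<close>

lemma line_in_polydisc:
  fixes \<zeta> :: "complex ^ 'n"
  assumes \<zeta>: "\<And>i. cmod (\<zeta> $ i) \<le> 1" and t: "cmod t < 1"
  shows "0 + t *s \<zeta> \<in> polydisc"
proof -
  have "cmod t * cmod (\<zeta> $ i) < 1" for i
    using t mult_left_mono[OF \<zeta>[of i], of "cmod t"] by simp
  then show ?thesis by (simp add: polydisc_def norm_mult)
qed

text \<open>The bound 3/4 on \<open>\<rho>\<close> keeps the disc where the Cauchy estimates hold.
  The last condition makes the coefficients of the linear system small enough for
  \<open>linear_system_slope_bound\<close>.\<close>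

lemma gradient_jacobian_det_bound:
  fixes f :: "complex ^ 'n \<Rightarrow> complex ^ 'n"
  assumes n2: "CARD('n) \<ge> 2" and f: "f \<in> schwarzian_family \<alpha>" and \<alpha>: "0 \<le> \<alpha>"
    and \<rho>: "0 < \<rho>" "\<rho> \<le> 3 / 4" "\<rho> * (6400 * real CARD('n) ^ 4 * \<alpha>) \<le> 1 / (30 * real CARD('n))"
  shows "norm (gradient (jacobian_det f) 0) \<le> (real CARD('n) + 1) * (3 / (2 * \<rho>))"
proof -
  define n where "n = real CARD('n)"
  have n: "n \<ge> 2" using n2 by (simp add: n_def)
  interpret locally_biholomorphic_map f polydisc
    using f by unfold_locales (auto simp: schwarzian_family_def open_polydisc)
  have J0: "jacobian_det f 0 = 1" and Sf: "schwarzian_norm f \<le> ereal \<alpha>"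
    using f by (auto simp: schwarzian_family_def jacobian_det_def)
  have S_bd: "cmod (\<S> k i j z) \<le> 80 * \<alpha>" if z: "\<And>i. cmod (z $ i) \<le> 7 / 8" for k i j z
  proof -
    have "z \<in> polydisc" by (rule polydiscI[OF z]) simp
    then have "\<S> k a b z = \<S> k b a z" for a b by (rule \<S>_sym)
    then show ?thesis
      unfolding \<S>_def by (intro schwarzian_bound[OF Sf \<alpha> _ z])
  qed
  \<comment> \<open>Cauchy's estimate on circles of radius 1/8 multiplies the bound
    \<open>80 * \<alpha>\<close> by 8.\<close>
  have dS_bd: "cmod (partial m (\<S> k i j) z) \<le> 640 * \<alpha>" if z: "\<And>i. cmod (z $ i) \<le> 3 / 4" for m k i j z
  proof -
    have b: "cmod ((z + x *s axis m 1) $ a) \<le> 7 / 8" if "cmod x \<le> 1 / 8" for x a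
      using z[of a] that norm_triangle_ineq[of "z $ a" "axis m x $ a"]
      by (auto simp: smult_axis axis_def)
    have "cmod (partial m (\<S> k i j) z) \<le> 80 * \<alpha> / (1 / 8)"
    proof (rule partial_bound[OF \<S>_mholomorphic])
      show "z + x *s axis m 1 \<in> polydisc" if "cmod x \<le> 1 / 8" for x
        by (rule polydiscI[OF b[OF that]]) simp
      show "cmod (\<S> k i j (z + x *s axis m 1)) \<le> 80 * \<alpha>" if "cmod x \<le> 1 / 8" for x
        by (rule S_bd) (rule b[OF that])
    qed simp
    then show ?thesis by simp
  qed
  \<comment> \<open>There are \<open>n\<^sup>2\<close> products of size at most
    \<open>(80 * \<alpha>)\<^sup>2\<close> and \<open>n\<close> derivatives; the denominator
    \<open>n - 1\<close> is at least 1.\<close>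
  have R_bd: "cmod (R i j z) \<le> 6400 * n\<^sup>2 * (\<alpha> * (1 + \<alpha>))" if z: "\<And>i. cmod (z $ i) \<le> 3 / 4" for i j z
  proof -
    have z': "cmod (z $ i) \<le> 7 / 8" for i using z[of i] by simp
    have "cmod ((\<Sum>m\<in>UNIV. \<Sum>k\<in>UNIV. \<S> m i k z * \<S> k m j z) - (\<Sum>m\<in>UNIV. partial m (\<S> m i j) z))
        \<le> (\<Sum>m\<in>(UNIV::'n set). \<Sum>k\<in>(UNIV::'n set). (80 * \<alpha>) * (80 * \<alpha>)) + (\<Sum>m\<in>(UNIV::'n set). 640 * \<alpha>)"
      by (intro order_trans[OF norm_triangle_ineq4] add_mono sum_norm_le dS_bd z order_trans[OF norm_mult_ineq] mult_mono S_bd z')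
         (use \<alpha> in auto)
    also have "\<dots> = 6400 * n\<^sup>2 * \<alpha>\<^sup>2 + 640 * n * \<alpha>"
      by (simp add: n_def power2_eq_square)
    also have "640 * n * \<alpha> \<le> 6400 * n\<^sup>2 * \<alpha>"
      using n \<alpha> by (intro mult_right_mono) (auto simp: power2_eq_square)
    finally have *: "cmod ((\<Sum>m\<in>UNIV. \<Sum>k\<in>UNIV. \<S> m i k z * \<S> k m j z) - (\<Sum>m\<in>UNIV. partial m (\<S> m i j) z))
        \<le> 6400 * n\<^sup>2 * (\<alpha> * (1 + \<alpha>))" by (simp add: algebra_simps power2_eq_square)
    have "cmod (of_nat CARD('n) - 1) = n - 1"
      using n norm_of_real[of "n - 1", where 'a = complex] by (simp add: n_def)
    then have "cmod (R i j z) = cmod ((\<Sum>m\<in>UNIV. \<Sum>k\<in>UNIV. \<S> m i k z * \<S> k m j z) - (\<Sum>m\<in>UNIV. partial m (\<S> m i j) z)) / (n - 1)"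
      by (simp add: R_def norm_divide)
    also have "\<dots> \<le> cmod ((\<Sum>m\<in>UNIV. \<Sum>k\<in>UNIV. \<S> m i k z * \<S> k m j z) - (\<Sum>m\<in>UNIV. partial m (\<S> m i j) z)) / 1"
      using n by (intro divide_left_mono) auto
    finally show ?thesis using * by simp
  qed

  define A where "A = norm (\<chi> j. p j 0)"
  have "gradient (jacobian_det f) 0 $ j = (- (of_nat CARD('n) + 1) *s (\<chi> j. p j 0)) $ j" for j
  proof -
    have "of_nat CARD('n) + 1 \<noteq> (0 :: complex)"
      using of_nat_neq_0[of "CARD('n)"] by (simp add: add.commute)
    moreover have "x = - c * (- (1 / c) * x)" if "c \<noteq> 0" for c x :: complex
      using that by simp
    ultimately show ?thesis
      by (simp only: gradient_def p_def partial_log_def J0 vec_lambda_beta vector_smult_component div_by_1)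
  qed
  then have "gradient (jacobian_det f) 0 = (- complex_of_real (n + 1)) *s (\<chi> j. p j 0)"
    by (simp add: vec_eq_iff n_def)
  also have "\<dots> = (- (n + 1)) *\<^sub>R (\<chi> j. p j 0)"
    by (simp add: vec_eq_iff scaleR_conv_of_real[where 'a = complex] algebra_simps)
  finally have grad: "norm (gradient (jacobian_det f) 0) = (n + 1) * A"
    using n by (simp only: norm_scaleR A_def)
  have "A \<le> 3 / (2 * \<rho>)"
  proof (cases "A = 0")
    case False
    then have A: "A > 0" by (simp add: A_def)
    have p_le: "cmod (p j 0) \<le> A" for j
      using Finite_Cartesian_Product.norm_nth_le[of "\<chi> j. p j 0" j] by (simp add: A_def)
    \<comment> \<open>Conjugation makes the sum of \<open>\<zeta> $ j * p j 0\<close> equal to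
      \<open>A\<close>, the largest slope a unit direction can give.\<close>
    define \<zeta> :: "complex ^ 'n" where "\<zeta> = (\<chi> j. cnj (p j 0) / of_real A)"
    have \<zeta>: "cmod (\<zeta> $ j) \<le> 1" for j
      using p_le[of j] A by (simp add: \<zeta>_def norm_divide)
    note line = line_in_polydisc[OF \<zeta>]
    define c where "c t = 0 + t *s \<zeta>" for t
    have c0: "c 0 = 0" by (simp add: c_def vec_eq_iff)
    have c_le: "cmod (c t $ i) \<le> 3 / 4" if "cmod t \<le> \<rho>" for t i
      using mult_mono[of "cmod t" "3 / 4" "cmod (\<zeta> $ i)" 1] that \<rho>(2) \<zeta>[of i]
      by (simp add: c_def norm_mult)
    have cP: "c t \<in> polydisc" if "cmod t < 1" for t
      unfolding c_def by (rule line[OF that])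
    have der: "((\<lambda>t. g (c t)) has_field_derivative (\<Sum>j\<in>UNIV. partial j g (c t) * \<zeta> $ j)) (at t)"
      if "g mholomorphic_on polydisc" "cmod t < 1" for g t
      unfolding c_def by (rule mholomorphic_DERIV_line[OF that(1) line[OF that(2)]])
    \<comment> \<open>The logarithmic derivative of \<open>u\<close> along the line. Exponentiating
      its primitive yields \<open>u\<close> without choosing a branch of the root of the Jacobian
      determinant, and shows that it has no zeros.\<close>
    define q where "q t = (\<Sum>j\<in>UNIV. \<zeta> $ j * p j (c t))" for t
    have "(\<lambda>t. p j (c t)) field_differentiable at t within ball 0 1" if "cmod t < 1" for j t
      unfolding field_differentiable_def
      by (rule exI, rule has_field_derivative_at_within, rule der[OF p_mholomorphic that])
    then have "(\<lambda>t. p j (c t)) holomorphic_on ball 0 1" for j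
      by (simp add: holomorphic_on_def)
    then have "q holomorphic_on ball 0 1"
      unfolding q_def by (intro holomorphic_intros)
    then obtain L where L: "\<And>t. t \<in> ball 0 1 \<Longrightarrow> (L has_field_derivative q t) (at t within ball 0 1)"
      using holomorphic_convex_primitive'[OF convex_ball open_ball] by metis
    have L: "(L has_field_derivative q t) (at t)" if "cmod t < 1" for t
      using L[of t] that by (simp add: at_within_open[of t "ball 0 1"])
    define \<phi> where "\<phi> t = exp (L t - L 0)" for t
    have \<phi>: "(\<phi> has_field_derivative q t * \<phi> t) (at t)" if "cmod t < 1" for t
      unfolding \<phi>_def by (auto intro!: derivative_eq_intros L that)
    txt \<open>\<open>\<phi>\<close> and \<open>w i\<close> are \<open>u\<close> and \<open>\<partial>\<^sub>i u\<close> along the line \<open>c\<close>; the factor \<open>\<phi>\<close> linearises the Riccati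
      equation \<open>partial_p\<close>.\<close>
    define w where "w i t = p i (c t) * \<phi> t" for i t
    show ?thesis
    proof (rule linear_system_slope_bound[where w = w and \<phi> = \<phi> and \<zeta> = "\<lambda>j. \<zeta> $ j" and \<alpha> = \<alpha>
          and P = "\<lambda>i k t. \<Sum>j\<in>UNIV. \<zeta> $ j * \<S> k j i (c t)" and Q = "\<lambda>i t. \<Sum>j\<in>UNIV. \<zeta> $ j * R j i (c t)"
          and p = "n * (80 * \<alpha>)" and q = "n * (6400 * n\<^sup>2 * (\<alpha> * (1 + \<alpha>)))"])
      fix t assume "cmod t \<le> \<rho>"
      then have t: "cmod t < 1" using \<rho> by simp
      show "(\<phi> has_field_derivative (\<Sum>j\<in>UNIV. \<zeta> $ j * w j t)) (at t)"
        using \<phi>[OF t] by (simp add: q_def w_def sum_distrib_right mult.assoc)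
    next
      fix i t assume "cmod t \<le> \<rho>"
      then have t: "cmod t < 1" using \<rho> by simp
      \<comment> \<open>Along the line the quadratic term of \<open>partial_p\<close> collects to
        \<open>- q t * p i (c t)\<close>, which cancels the contribution of the derivative of
        \<open>\<phi>\<close> in the product rule below.\<close>
      have dp: "(\<Sum>j\<in>UNIV. partial j (p i) (c t) * \<zeta> $ j) =
          (\<Sum>j\<in>UNIV. \<zeta> $ j * R j i (c t)) + (\<Sum>k\<in>UNIV. (\<Sum>j\<in>UNIV. \<zeta> $ j * \<S> k j i (c t)) * p k (c t)) - q t * p i (c t)"
      proof -
        have "(\<Sum>j\<in>UNIV. partial j (p i) (c t) * \<zeta> $ j) =
            (\<Sum>j\<in>UNIV. \<zeta> $ j * R j i (c t) + (\<Sum>k\<in>UNIV. \<zeta> $ j * \<S> k j i (c t) * p k (c t)) - \<zeta> $ j * p j (c t) * p i (c t))"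
          by (intro sum.cong refl) (simp add: partial_p[OF n2 cP[OF t]] algebra_simps sum_distrib_left)
        also have "\<dots> = (\<Sum>j\<in>UNIV. \<zeta> $ j * R j i (c t)) + (\<Sum>j\<in>UNIV. \<Sum>k\<in>UNIV. \<zeta> $ j * \<S> k j i (c t) * p k (c t)) - q t * p i (c t)"
          by (simp add: sum.distrib sum_subtractf q_def sum_distrib_right)
        also have "(\<Sum>j\<in>UNIV. \<Sum>k\<in>UNIV. \<zeta> $ j * \<S> k j i (c t) * p k (c t)) = (\<Sum>k\<in>UNIV. (\<Sum>j\<in>UNIV. \<zeta> $ j * \<S> k j i (c t)) * p k (c t))"
          by (subst sum.swap) (simp add: sum_distrib_right)
        finally show ?thesis .
      qed
      have "(w i has_field_derivative ((\<Sum>j\<in>UNIV. partial j (p i) (c t) * \<zeta> $ j) * \<phi> t + (q t * \<phi> t) * p i (c t))) (at t)"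
        unfolding w_def by (rule DERIV_mult[OF der[OF p_mholomorphic t] \<phi>[OF t]])
      then show "(w i has_field_derivative (\<Sum>k\<in>UNIV. (\<Sum>j\<in>UNIV. \<zeta> $ j * \<S> k j i (c t)) * w k t)
          + (\<Sum>j\<in>UNIV. \<zeta> $ j * R j i (c t)) * \<phi> t) (at t)"
        unfolding dp by (rule DERIV_cong) (simp add: w_def algebra_simps sum_distrib_left)
    next
      have "(\<Sum>j\<in>UNIV. \<zeta> $ j * p j 0) = of_real ((\<Sum>j\<in>UNIV. (cmod (p j 0))\<^sup>2) / A)"
        by (simp add: \<zeta>_def complex_norm_square mult.commute sum_divide_distrib del: of_real_power)
      also have "(\<Sum>j\<in>UNIV. (cmod (p j 0))\<^sup>2) = A\<^sup>2"
        by (simp add: A_def norm_vec_def L2_set_def sum_nonneg)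
      finally show "(\<Sum>j\<in>UNIV. \<zeta> $ j * w j 0) = of_real A"
        using A by (simp add: w_def c0 \<phi>_def power2_eq_square)
    next
      fix i k t assume t: "cmod t \<le> \<rho>"
      have "cmod (\<Sum>j\<in>UNIV. \<zeta> $ j * \<S> k j i (c t)) \<le> (\<Sum>j\<in>(UNIV::'n set). 1 * (80 * \<alpha>))"
        using order_trans[OF c_le[OF t], of "7 / 8"]
        by (intro sum_norm_le order_trans[OF norm_mult_ineq] mult_mono \<zeta> S_bd) auto
      then show "cmod (\<Sum>j\<in>UNIV. \<zeta> $ j * \<S> k j i (c t)) \<le> n * (80 * \<alpha>)"
        by (simp add: n_def)
    next
      fix i t assume t: "cmod t \<le> \<rho>"
      have "cmod (\<Sum>j\<in>UNIV. \<zeta> $ j * R j i (c t)) \<le> (\<Sum>j\<in>(UNIV::'n set). 1 * (6400 * n\<^sup>2 * (\<alpha> * (1 + \<alpha>))))"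
        by (intro sum_norm_le order_trans[OF norm_mult_ineq] mult_mono \<zeta> R_bd c_le[OF t]) auto
      then show "cmod (\<Sum>j\<in>UNIV. \<zeta> $ j * R j i (c t)) \<le> n * (6400 * n\<^sup>2 * (\<alpha> * (1 + \<alpha>)))"
        by (simp add: n_def)
    next
      \<comment> \<open>Multiplied by \<open>n\<close>, the bound for \<open>Q\<close> is
        \<open>6400 * n ^ 4 * \<alpha> * (1 + \<alpha>)\<close>, which fixes the constant in the
        hypothesis; the bound for \<open>P\<close> and \<open>\<alpha>\<close> itself are dominated
        by \<open>6400 * n ^ 4 * \<alpha>\<close>.\<close>
      have k: "\<rho> * (6400 * n ^ 4 * \<alpha>) \<le> 1 / (30 * n)" using \<rho>(3) by (simp add: n_def)
      have n4: "1 \<le> n ^ 4" using n by (intro one_le_power) auto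
      have "1 * (\<rho> * \<alpha>) \<le> 6400 * n ^ 4 * (\<rho> * \<alpha>)"
        using n4 \<rho> \<alpha> by (intro mult_right_mono) auto
      also have "\<dots> \<le> 1 / (30 * n)" using k by (simp add: mult_ac)
      also have "\<dots> \<le> 1" using n by simp
      finally show "\<rho> * \<alpha> \<le> 1" by simp
      have "n\<^sup>2 \<le> n ^ 4" using n by (intro power_increasing) auto
      then have "80 * n\<^sup>2 \<le> 6400 * n ^ 4" using zero_le_power2[of n] by linarith
      then have "\<rho> * \<alpha> * (80 * n\<^sup>2) \<le> \<rho> * \<alpha> * (6400 * n ^ 4)"
        using \<rho> \<alpha> by (intro mult_left_mono) auto
      then show "\<rho> * (real CARD('n) * (n * (80 * \<alpha>))) \<le> 1 / (30 * n)"
        using k by (simp add: n_def[symmetric] power2_eq_square mult_ac)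
      have "\<rho> * (real CARD('n) * (n * (6400 * n\<^sup>2 * (\<alpha> * (1 + \<alpha>))))) = \<rho> * (6400 * n ^ 4 * \<alpha>) * (1 + \<alpha>)"
        unfolding n_def[symmetric] by (simp add: power2_eq_square power4_eq_xxxx mult_ac)
      also have "\<dots> \<le> 1 / (30 * n) * (1 + \<alpha>)"
        using k \<alpha> by (intro mult_right_mono) auto
      finally show "\<rho> * (real CARD('n) * (n * (6400 * n\<^sup>2 * (\<alpha> * (1 + \<alpha>))))) \<le> 1 / (30 * n) * (1 + \<alpha>)" .
    qed (use \<rho> \<alpha> \<zeta> p_le in \<open>auto simp: \<phi>_def w_def c0 n_def\<close>)
  qed (use \<rho> in simp)
  then show ?thesis
    unfolding grad n_def[symmetric] using n by (intro mult_left_mono) auto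
qed

section \<open>Choice of the radius and passage to the power of \<alpha>\<close>

theorem theorem4p2:
  fixes \<sigma> :: real
  assumes "CARD('n::finite) \<ge> 2" and "\<sigma> > 0"
  shows "\<exists>m::real. m > 0 \<and> (\<forall>\<alpha>\<ge>0.
           family_order TYPE('n) \<alpha> \<le> ereal (2 * (real CARD('n) + 1) + m * \<alpha> powr (1 + \<sigma>)))"
proof -
  define n where "n = real CARD('n)"
  have n: "n \<ge> 2" using assms by (simp add: n_def)
  \<comment> \<open>Makes the smallness condition of \<open>gradient_jacobian_det_bound\<close> read
    \<open>\<rho> * (K * \<alpha>) \<le> 1\<close>.\<close>
  define K where "K = 6400 * n ^ 4 * (30 * n)"
  have K: "K > 0" using n by (simp add: K_def)
  \<comment> \<open>The threshold at which the admissible radius \<open>1 / (K * \<alpha>)\<close>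
    equals 3/4.\<close>
  define \<alpha>0 where "\<alpha>0 = 4 / (3 * K)"
  have \<alpha>0: "\<alpha>0 > 0" using K by (simp add: \<alpha>0_def)
  define m where "m = 2 * (n + 1) * (1 / \<alpha>0) powr (1 + \<sigma>)"
  have m: "m > 0" using n \<alpha>0 by (simp add: m_def)
  have bound: "norm (gradient (jacobian_det f) 0) \<le> 2 * (n + 1) + m * \<alpha> powr (1 + \<sigma>)"
    if \<alpha>: "0 \<le> \<alpha>" and f: "f \<in> schwarzian_family \<alpha>" for \<alpha> and f :: "complex ^ 'n \<Rightarrow> complex ^ 'n"
  proof -
    have main: "norm (gradient (jacobian_det f) 0) \<le> (n + 1) * (3 / (2 * \<rho>))"
      if "0 < \<rho>" "\<rho> \<le> 3 / 4" "\<rho> * (K * \<alpha>) \<le> 1" for \<rho>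
      unfolding n_def using that n
      by (intro gradient_jacobian_det_bound[OF assms(1) f \<alpha>])
         (auto simp: K_def n_def[symmetric] field_simps)
    show ?thesis
    proof (cases "\<alpha> \<le> \<alpha>0")
      case True
      \<comment> \<open>Up to the threshold the full radius 3/4 is admissible and gives exactly
        \<open>2 * (n + 1)\<close>.\<close>
      have "3 / 4 * (K * \<alpha>) \<le> 1"
        using True K by (simp add: \<alpha>0_def field_simps)
      from main[OF _ _ this] have "norm (gradient (jacobian_det f) 0) \<le> (n + 1) * 2" by simp
      also have "\<dots> \<le> 2 * (n + 1) + m * \<alpha> powr (1 + \<sigma>)"
        using m by simp
      finally show ?thesis .
    next
      case False
      then have a: "\<alpha> > \<alpha>0" "\<alpha> > 0" using \<alpha>0 by auto
      have "1 / (K * \<alpha>) \<le> 3 / 4"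
        using a(1) a(2) K by (simp add: \<alpha>0_def field_simps)
      then have "norm (gradient (jacobian_det f) 0) \<le> (n + 1) * (3 / (2 * (1 / (K * \<alpha>))))"
        using K a by (intro main) auto
      also have "\<dots> = 2 * (n + 1) * (\<alpha> / \<alpha>0)"
        using K by (simp add: \<alpha>0_def field_simps)
      \<comment> \<open>The linear bound suffices: above the threshold the base exceeds 1, so
        raising the exponent to \<open>1 + \<sigma>\<close> increases the value.\<close>
      also have "\<dots> \<le> 2 * (n + 1) * (\<alpha> / \<alpha>0) powr (1 + \<sigma>)"
        using powr_mono[of 1 "1 + \<sigma>" "\<alpha> / \<alpha>0"] a \<alpha>0 n assms(2) by (intro mult_left_mono) auto
      also have "\<dots> = m * \<alpha> powr (1 + \<sigma>)"
        using a \<alpha>0 powr_mult[of "1 / \<alpha>0" \<alpha> "1 + \<sigma>"] by (simp add: m_def)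
      finally show ?thesis using n by simp
    qed
  qed
  show ?thesis
    using bound m by (intro exI[of _ m] conjI allI impI)
      (auto simp: family_order_def n_def intro!: SUP_least)
qed

end
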